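(* Let $\gamma:\Gamma\to\Delta$ and $\lambda:\mathbb{S}\to\Delta$ be graph immersions, where $\mathbb{S}=\bigsqcup S^1$ is a disjoint union of circles. If $\lambda|_{S^1}$ is primitive for each component $S^1\subset\mathbb{S}$, then there are at most $\beta_1(\Gamma)$ many components $S^1\subset \mathrm{Core}(\Gamma\times_\Delta\mathbb{S})$ such that $$\deg\big(p_{\mathbb{S}}|_{S^1}\big)\ \ge\ 12\cdot\beta_1(\Gamma),$$ where $p_{\mathbb{S}}:\Gamma\times_\Delta\mathbb{S}\to\mathbb{S}$ is the natural projection map.
   Context: A graph is a directed graph $\Gamma=(V,E,o,t)$ with origin and target maps $o,t:E\to V$ (loops and multiple edges allowed). A graph map is a pair of maps on vertices and edges commuting with $o$ and $t$. It is an immersion if, at every vertex $v$, it is injective on the set of edges with origin $v$ and injective on the set of edges with target $v$. $\beta_1(\Gamma)$ is the first Betti number of the underlying topological graph. A circle is a graph with vertices $v_0,\dots,v_{k-1}$ and edges $e_0,\dots,e_{k-1}$ ($k\ge1$), $o(e_i)=v_i$, $t(e_i)=v_{i+1}$, indices mod $k$. A cycle in $\Gamma$ is a graph map $f:S^1\to\Gamma$ from a circle. The degree $\deg(f)$ of a cycle $f$ is the largest degree of a covering map $S^1\to S^1$ through which $f$ factors; $f$ is primitive if it does not factor properly through any other cycle. (For a covering of a circle by a circle, $\deg$ is the covering degree.) The fibre product $\Gamma\times_\Delta\Lambda$ of graph maps $\gamma:\Gamma\to\Delta$, $\lambda:\Lambda\to\Delta$ has vertices the pairs $(u,v)\in V(\Gamma)\times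 V(\Lambda)$ with $\gamma(u)=\lambda(v)$, edges the pairs $(e,f)\in E(\Gamma)\times E(\Lambda)$ with $\gamma(e)=\lambda(f)$, and $o,t$ defined coordinatewise. The core $\mathrm{Core}(\Gamma)$ of a graph is the union of the images of all cycles in it. Under the hypotheses above, each component of $\mathrm{Core}(\Gamma\times_\Delta\mathbb{S})$ is a circle which $p_{\mathbb{S}}$ maps onto a component of $\mathbb{S}$ by a covering.
   Formalization: Distinct components of S are assumed non-isomorphic as cycles over Δ; without this the claim fails: for Δ a single loop, S two copies of it and Γ its 12-fold cover, β₁(Γ)=1 but two components have degree 12. *)

theory Defs
  imports
    "Graph_Theory.Graph_Theory"
    "HOL-Library.Extended_Nat"
    "HOL-Library.Poly_Mapping"
    Complex_Main
begin

text \<open>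
  Graphs are the (possibly infinite) multi-digraphs with loops of the theory of
  \<^locale>\<open>wf_digraph\<close>: \<^const>\<open>tail\<close> is the origin map and \<^const>\<open>head\<close> the target map.
  Only the values of a graph map on \<^const>\<open>verts\<close> and \<^const>\<open>arcs\<close> matter, so
  equality of graph maps is always taken relative to the source graph.
\<close>

record ('a, 'b, 'c, 'd) graph_map =
  vmap :: "'a \<Rightarrow> 'c"
  amap :: "'b \<Rightarrow> 'd"

definition is_graph_map ::
    "('a, 'b) pre_digraph \<Rightarrow> ('c, 'd) pre_digraph \<Rightarrow> ('a, 'b, 'c, 'd) graph_map \<Rightarrow> bool" where
  "is_graph_map G H f \<longleftrightarrow> wf_digraph G \<and> wf_digraph H \<and>
     (\<forall>v \<in> verts G. vmap f v \<in> verts H) \<and>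
     (\<forall>e \<in> arcs G. amap f e \<in> arcs H \<and>
        tail H (amap f e) = vmap f (tail G e) \<and>
        head H (amap f e) = vmap f (head G e))"

definition immersion ::
    "('a, 'b) pre_digraph \<Rightarrow> ('c, 'd) pre_digraph \<Rightarrow> ('a, 'b, 'c, 'd) graph_map \<Rightarrow> bool" where
  "immersion G H f \<longleftrightarrow> is_graph_map G H f \<and>
     (\<forall>v \<in> verts G. inj_on (amap f) (out_arcs G v) \<and> inj_on (amap f) (in_arcs G v))"

definition graph_iso ::
    "('a, 'b) pre_digraph \<Rightarrow> ('c, 'd) pre_digraph \<Rightarrow> ('a, 'b, 'c, 'd) graph_map \<Rightarrow> bool" where
  "graph_iso G H f \<longleftrightarrow> is_graph_map G H f \<and>
     bij_betw (vmap f) (verts G) (verts H) \<and> bij_betw (amap f) (arcs G) (arcs H)"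

definition covering_map ::
    "('a, 'b) pre_digraph \<Rightarrow> ('c, 'd) pre_digraph \<Rightarrow> ('a, 'b, 'c, 'd) graph_map \<Rightarrow> bool" where
  "covering_map G H p \<longleftrightarrow> is_graph_map G H p \<and> vmap p ` verts G = verts H \<and>
     (\<forall>v \<in> verts G.
        bij_betw (amap p) (out_arcs G v) (out_arcs H (vmap p v)) \<and>
        bij_betw (amap p) (in_arcs G v) (in_arcs H (vmap p v)))"

definition covering_of_degree ::
    "('a, 'b) pre_digraph \<Rightarrow> ('c, 'd) pre_digraph \<Rightarrow> ('a, 'b, 'c, 'd) graph_map \<Rightarrow> nat \<Rightarrow> bool" where
  "covering_of_degree G H p m \<longleftrightarrow> covering_map G H p \<and>
     (\<forall>w \<in> verts H. card {v \<in> verts G. vmap p v = w} = m)"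

definition factors_as ::
    "('a, 'b) pre_digraph \<Rightarrow> ('a, 'b, 'c, 'd) graph_map \<Rightarrow>
     ('e, 'f, 'c, 'd) graph_map \<Rightarrow> ('a, 'b, 'e, 'f) graph_map \<Rightarrow> bool" where
  "factors_as G f g p \<longleftrightarrow>
     (\<forall>v \<in> verts G. vmap f v = vmap g (vmap p v)) \<and>
     (\<forall>e \<in> arcs G. amap f e = amap g (amap p e))"


definition circle :: "nat \<Rightarrow> (nat, nat) pre_digraph" where
  "circle k = \<lparr> verts = {..<k}, arcs = {..<k}, tail = (\<lambda>i. i), head = (\<lambda>i. Suc i mod k) \<rparr>"

definition is_circle :: "('a, 'b) pre_digraph \<Rightarrow> bool" where
  "is_circle C \<longleftrightarrow> (\<exists>k \<ge> 1. digraph_iso (circle k) C)"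

text \<open>
  In the next two definitions \<open>C\<close> is a circle and \<open>f\<close> a cycle \<open>C \<rightarrow> G\<close>; it suffices
  to factor through the standard circles.
\<close>

definition cycle_degree ::
    "('a, 'b) pre_digraph \<Rightarrow> ('c, 'd) pre_digraph \<Rightarrow> ('a, 'b, 'c, 'd) graph_map \<Rightarrow> nat" where
  "cycle_degree C G f = Max {m. \<exists>k \<ge> 1. \<exists>p g.
     covering_of_degree C (circle k) p m \<and> is_graph_map (circle k) G g \<and> factors_as C f g p}"

definition primitive_cycle ::
    "('a, 'b) pre_digraph \<Rightarrow> ('c, 'd) pre_digraph \<Rightarrow> ('a, 'b, 'c, 'd) graph_map \<Rightarrow> bool" where
  "primitive_cycle C G f \<longleftrightarrow> (\<forall>k \<ge> 1. \<forall>p g.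
     is_graph_map C (circle k) p \<and> is_graph_map (circle k) G g \<and> factors_as C f g p
       \<longrightarrow> graph_iso C (circle k) p)"

text \<open>
  Being an immersion does not prevent two components of a disjoint union of circles from
  being isomorphic over the target graph.  Bounds counting components of a fibre product
  need such repetitions excluded: if \<open>\<Delta>\<close> is a single loop, \<open>S\<close> two disjoint copies
  of \<open>\<Delta>\<close> and \<open>\<Gamma>\<close> the 12-fold cover of \<open>\<Delta>\<close>, then the first Betti number of
  \<open>\<Gamma>\<close> is 1, but the fibre product is two circles, each of degree 12.
\<close>

definition equivalent_cycles ::
    "('a, 'b) pre_digraph \<Rightarrow> ('a, 'b, 'c, 'd) graph_map \<Rightarrow>
     ('e, 'f) pre_digraph \<Rightarrow> ('e, 'f, 'c, 'd) graph_map \<Rightarrow> bool" where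
  "equivalent_cycles C f C' f' \<longleftrightarrow> (\<exists>p. graph_iso C C' p \<and> factors_as C f f' p)"


text \<open>Here \<^const>\<open>connected\<close> refers to the underlying undirected graph.\<close>

definition components :: "('a, 'b) pre_digraph \<Rightarrow> ('a, 'b) pre_digraph set" where
  "components G = {H. pre_digraph.max_subgraph G Digraph_Component.connected H}"

definition graph_image ::
    "('a, 'b, 'c, 'd) graph_map \<Rightarrow> ('a, 'b) pre_digraph \<Rightarrow> ('c, 'd) pre_digraph \<Rightarrow>
     ('c, 'd) pre_digraph" where
  "graph_image f C G =
     \<lparr> verts = vmap f ` verts C, arcs = amap f ` arcs C, tail = tail G, head = head G \<rparr>"

definition core :: "('a, 'b) pre_digraph \<Rightarrow> ('a, 'b) pre_digraph" where
  "core G = pre_digraph.Union G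
     {graph_image f (circle k) G | k f. k \<ge> 1 \<and> is_graph_map (circle k) G f}"

definition fibre_product ::
    "('a, 'b) pre_digraph \<Rightarrow> ('a, 'b, 'e, 'f) graph_map \<Rightarrow>
     ('c, 'd) pre_digraph \<Rightarrow> ('c, 'd, 'e, 'f) graph_map \<Rightarrow>
     ('a \<times> 'c, 'b \<times> 'd) pre_digraph" where
  "fibre_product G g L l =
     \<lparr> verts = {(u, v). u \<in> verts G \<and> v \<in> verts L \<and> vmap g u = vmap l v},
       arcs = {(e, f). e \<in> arcs G \<and> f \<in> arcs L \<and> amap g e = amap l f},
       tail = (\<lambda>(e, f). (tail G e, tail L f)),
       head = (\<lambda>(e, f). (head G e, head L f)) \<rparr>"

definition proj_snd :: "('a \<times> 'c, 'b \<times> 'd, 'c, 'd) graph_map" where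
  "proj_snd = \<lparr> vmap = snd, amap = snd \<rparr>"


text \<open>
  A graph has no 2-cells, so its first homology with real coefficients is the kernel of
  the boundary map from finitely supported real 1-chains to 0-chains.  The Betti number
  is the dimension of this kernel, as an extended natural number because the graph may
  be infinite.
\<close>

definition boundary :: "('a, 'b) pre_digraph \<Rightarrow> ('b \<Rightarrow>\<^sub>0 real) \<Rightarrow> ('a \<Rightarrow>\<^sub>0 real)" where
  "boundary G c = (\<Sum>e \<in> Poly_Mapping.keys c.
     Poly_Mapping.single (head G e) (Poly_Mapping.lookup c e) -
     Poly_Mapping.single (tail G e) (Poly_Mapping.lookup c e))"

definition cycle_space :: "('a, 'b) pre_digraph \<Rightarrow> ('b \<Rightarrow>\<^sub>0 real) set" where
  "cycle_space G = {c. Poly_Mapping.keys c \<subseteq> arcs G \<and> boundary G c = 0}"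

definition betti1 :: "('a, 'b) pre_digraph \<Rightarrow> enat" where
  "betti1 G = Sup {enat (card B) | B. finite B \<and> B \<subseteq> cycle_space G \<and>
     \<not> module.dependent (\<lambda>r. Poly_Mapping.map ((*) r)) B}"

end

theory Submission
  imports Defs "HOL-Number_Theory.Cong"
begin

text \<open>
  Project the circles of the core to \<open>\<Gamma>\<close>. It suffices that among any finitely many of those of
  large degree, one passes over some arc of \<open>\<Gamma>\<close> exactly once and the others not at all: then
  their classes in the first homology of \<open>\<Gamma>\<close> are linearly independent.

  Let \<open>b\<close> be the Betti number, choose among these circles one, \<open>C\<close>, whose period \<open>L\<close> is maximal, and
  stack the points of \<open>C\<close> over each vertex of \<open>\<Gamma>\<close> by the lexicographic order of the words read onwards
  from them. The image of the circles has at most \<open>b\<close> more arcs than vertices, so \<open>C\<close> switches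
  between highest and not highest at most \<open>2 b\<close> times, and runs as the highest point through a vertex
  with several outgoing arcs at most \<open>b\<close> times. Since \<open>C\<close> contains more than \<open>3 b\<close> disjoint segments of
  length \<open>2 L\<close>, some segment avoids all these events. It contains a lexicographically maximal position,
  hence it is highest throughout and meets no branching. Another point over its first arc would
  therefore read the same word for at least the sum of the two periods, which by Fine and Wilf
  contradicts primitivity or inequivalence.
\<close>

section \<open>Labelled circles over a graph\<close>

text \<open>Ties inside a fibre are excluded by \<open>inj\<close>, so each nonempty fibre of
  \<open>f\<close> contains exactly one maximum of \<open>\<rho>\<close>. Applied to the points over
  a vertex and to the points over an arc.\<close>

lemma card_fibre_maxima:
  fixes \<rho> :: "'a \<Rightarrow> real"
  assumes "finite C"
    and inj: "\<And>x y. x \<in> C \<Longrightarrow> y \<in> C \<Longrightarrow> f x = f y \<Longrightarrow> \<rho> x = \<rho> y \<Longrightarrow> x = y"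
  shows "card {x \<in> C. \<forall>y\<in>C. f y = f x \<longrightarrow> \<rho> y \<le> \<rho> x} = card (f ` C)"
    and "inj_on f {x \<in> C. \<forall>y\<in>C. f y = f x \<longrightarrow> \<rho> y \<le> \<rho> x}"
proof -
  let ?M = "{x \<in> C. \<forall>y\<in>C. f y = f x \<longrightarrow> \<rho> y \<le> \<rho> x}"
  show inj_f: "inj_on f ?M"
    by (intro inj_onI inj) (auto intro: antisym)
  have "f z \<in> f ` ?M" if "z \<in> C" for z
  proof -
    let ?F = "{y \<in> C. f y = f z}"
    have "finite (\<rho> ` ?F)" "\<rho> ` ?F \<noteq> {}"
      using \<open>finite C\<close> that by auto
    then have "Max (\<rho> ` ?F) \<in> \<rho> ` ?F" and le: "\<And>y. y \<in> ?F \<Longrightarrow> \<rho> y \<le> Max (\<rho> ` ?F)"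
      by (auto intro!: Max_in)
    then obtain x where "x \<in> ?F" "\<rho> x = Max (\<rho> ` ?F)"
      by auto
    then show ?thesis
      using le by (intro image_eqI[of _ _ x]) auto
  qed
  then have "f ` ?M = f ` C"
    by auto
  then show "card ?M = card (f ` C)"
    using card_image[OF inj_f] by simp
qed

text \<open>Pick \<open>c v\<close> in every fibre and a second element \<open>d v\<close> in every
  fibre over \<open>B\<close>; all these elements of \<open>E\<close> are distinct. With
  \<open>f\<close> the origin map, this bounds the number of branching vertices by the excess of
  arcs over vertices.\<close>

lemma card_branchings:
  assumes "finite E" "B \<subseteq> f ` E"
    and two: "\<And>v. v \<in> B \<Longrightarrow> \<exists>x\<in>E. \<exists>y\<in>E. x \<noteq> y \<and> f x = v \<and> f y = v"
  shows "card (f ` E) + card B \<le> card E"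
proof -
  define c where "c = inv_into E f"
  have c: "c v \<in> E" "f (c v) = v" if "v \<in> f ` E" for v
    using that by (auto simp: c_def inv_into_into f_inv_into_f)
  have "\<exists>y\<in>E. y \<noteq> c v \<and> f y = v" if "v \<in> B" for v
    using two[OF that] by metis
  then obtain d where d: "\<And>v. v \<in> B \<Longrightarrow> d v \<in> E \<and> d v \<noteq> c v \<and> f (d v) = v"
    by metis
  have "card (f ` E) + card B = card (c ` f ` E) + card (d ` B)"
    using inj_on_inverseI[of "f ` E" f c] inj_on_inverseI[of B f d] c d by (simp add: card_image)
  also have "\<dots> = card (c ` f ` E \<union> d ` B)"
  proof (intro card_Un_disjoint[symmetric])
    show "c ` f ` E \<inter> d ` B = {}"
    proof -
      have "c u \<noteq> d v" if "u \<in> f ` E" "v \<in> B" for u v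
        using c(2)[OF that(1)] d[OF that(2)] by auto
      then show ?thesis
        by auto
    qed
    show "finite (d ` B)"
      using assms(1,2) by (blast intro: finite_subset)
  qed (use assms in auto)
  also have "\<dots> \<le> card E"
    using c d assms(1) by (intro card_mono) auto
  finally show ?thesis .
qed

text \<open>
  A point of \<open>P\<close> is an arc of one of finitely many circles lying over a graph: \<open>T\<close> is the next arc of
  the circle, \<open>ed\<close> the arc below, with origin \<open>og\<close> and target \<open>tg\<close>, and \<open>per\<close> a period of the
  label word read along the circle.
\<close>

locale labelled_circles =
  fixes P :: "'p set" and T :: "'p \<Rightarrow> 'p" and ed :: "'p \<Rightarrow> 'e"
    and og tg :: "'e \<Rightarrow> 'v" and lab :: "'e \<Rightarrow> nat" and per :: "'p \<Rightarrow> nat"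
  assumes finite_P: "finite P"
    and T_in: "\<And>x. x \<in> P \<Longrightarrow> T x \<in> P"
    and T_inj: "inj_on T P"
    and tg_ed: "\<And>x. x \<in> P \<Longrightarrow> tg (ed x) = og (ed (T x))"
    and det: "\<And>x y. x \<in> P \<Longrightarrow> y \<in> P \<Longrightarrow> og (ed x) = og (ed y) \<Longrightarrow> lab (ed x) = lab (ed y) \<Longrightarrow> ed x = ed y"
    and per_pos: "\<And>x. x \<in> P \<Longrightarrow> 0 < per x"
    and per_T: "\<And>x. x \<in> P \<Longrightarrow> per (T x) = per x"
    and periodic: "\<And>x. x \<in> P \<Longrightarrow> lab (ed ((T ^^ per x) x)) = lab (ed x)"
    and separated: "\<And>x y. x \<in> P \<Longrightarrow> y \<in> P \<Longrightarrow> og (ed x) = og (ed y) \<Longrightarrow>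
      (\<And>i. i < per x + per y \<Longrightarrow> lab (ed ((T ^^ i) x)) = lab (ed ((T ^^ i) y))) \<Longrightarrow> x = y"
begin

section \<open>Label words and their heights\<close>

lemma T_pow_in: "x \<in> P \<Longrightarrow> (T ^^ i) x \<in> P"
  by (induction i) (auto simp: T_in)

lemma per_T_pow: "x \<in> P \<Longrightarrow> per ((T ^^ i) x) = per x"
  by (induction i) (auto simp: T_pow_in per_T)

lemma lab_periodic: "x \<in> P \<Longrightarrow> lab (ed ((T ^^ (i + per x)) x)) = lab (ed ((T ^^ i) x))"
  using periodic[of "(T ^^ i) x"] T_pow_in[of x i] per_T_pow[of x i]
  by (simp add: funpow_add add.commute[of i])

text \<open>
  Comparing heights is comparing label words lexicographically: the height of a point is the number
  whose digits in the given base are the labels read onwards from it.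
\<close>

definition base :: real where
  "base = 2 + real (Max (lab ` ed ` P))"

definition height :: "'p \<Rightarrow> real" where
  "height x = suminf (\<lambda>i. real (lab (ed ((T ^^ i) x))) / base ^ Suc i)"

lemma lab_le: "x \<in> P \<Longrightarrow> real (lab (ed x)) \<le> base - 2"
  using finite_P by (auto simp: base_def intro!: Max_ge)

lemma base_ge: "base \<ge> 2"
  by (simp add: base_def)

lemma geometric_base: "(\<lambda>i. (base - 2) / base ^ Suc i) sums ((base - 2) / (base - 1))"
proof -
  have "(\<lambda>i. (base - 2) / base * (1 / base) ^ i) sums ((base - 2) / base * (1 / (1 - 1 / base)))"
    using base_ge by (intro sums_mult geometric_sums) auto
  moreover have "(base - 2) / base * (1 / (1 - 1 / base)) = (base - 2) / (base - 1)"
    using base_ge by (simp add: field_simps)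
  moreover have "(\<lambda>i. (base - 2) / base * (1 / base) ^ i) = (\<lambda>i. (base - 2) / base ^ Suc i)"
    by (simp add: power_divide)
  ultimately show ?thesis
    by (simp only:)
qed

lemma summable_height:
  assumes "x \<in> P"
  shows "summable (\<lambda>i. real (lab (ed ((T ^^ i) x))) / base ^ Suc i)"
proof (rule summable_comparison_test')
  show "summable (\<lambda>i. (base - 2) / base ^ Suc i)"
    using geometric_base by (rule sums_summable)
  show "norm (real (lab (ed ((T ^^ n) x))) / base ^ Suc n) \<le> (base - 2) / base ^ Suc n"
    if "0 \<le> n" for n
    using base_ge lab_le[OF T_pow_in[OF assms, of n]]
    by (simp add: abs_of_nonneg divide_right_mono)
qed

lemma height_nonneg: "x \<in> P \<Longrightarrow> 0 \<le> height x"
  unfolding height_def using base_ge by (intro suminf_nonneg summable_height) auto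

text \<open>Digits of at most \<open>base - 2\<close> sum to at most
  \<open>(base - 2) / (base - 1)\<close>. The strict bound rules out double expansions like 0.999...
  = 1, which is why \<open>base\<close> exceeds the largest label by 2.\<close>

lemma height_less_1:
  assumes "x \<in> P"
  shows "height x < 1"
proof -
  have "height x \<le> suminf (\<lambda>i. (base - 2) / base ^ Suc i)"
    unfolding height_def
  proof (intro suminf_le summable_height assms)
    show "summable (\<lambda>i. (base - 2) / base ^ Suc i)"
      using geometric_base by (rule sums_summable)
    show "real (lab (ed ((T ^^ n) x))) / base ^ Suc n \<le> (base - 2) / base ^ Suc n" for n
      using base_ge lab_le[OF T_pow_in[OF assms, of n]] by (simp add: divide_right_mono)
  qed
  also have "\<dots> = (base - 2) / (base - 1)"
    using geometric_base by (rule sums_unique[symmetric])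
  also have "\<dots> < 1"
    using base_ge by simp
  finally show ?thesis .
qed

lemma height_step:
  assumes "x \<in> P"
  shows "base * height x = real (lab (ed x)) + height (T x)"
proof -
  let ?f = "\<lambda>x i. real (lab (ed ((T ^^ i) x))) / base ^ Suc i"
  have "suminf (\<lambda>i. ?f x (Suc i)) = suminf (?f x) - ?f x 0"
    by (rule suminf_split_head[OF summable_height[OF assms]])
  moreover have "(\<lambda>i. ?f x (Suc i)) = (\<lambda>i. ?f (T x) i / base)"
    by (simp add: funpow_swap1 mult.commute)
  moreover have "suminf (\<lambda>i. ?f (T x) i / base) = suminf (?f (T x)) / base"
    by (rule suminf_divide[OF summable_height[OF T_in[OF assms]]])
  ultimately have "height (T x) / base = height x - real (lab (ed x)) / base"
    unfolding height_def by simp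
  then show ?thesis
    using base_ge by (simp add: field_simps)
qed

text \<open>Both points read the same first label, so deleting this digit keeps their order: points
  over a common arc move along it without overtaking.\<close>

lemma height_T_le_iff:
  assumes "x \<in> P" "y \<in> P" "ed x = ed y"
  shows "height (T x) \<le> height (T y) \<longleftrightarrow> height x \<le> height y"
proof -
  have "height (T x) \<le> height (T y) \<longleftrightarrow> base * height x \<le> base * height y"
    using height_step[OF assms(1)] height_step[OF assms(2)] assms(3) by auto
  then show ?thesis
    using base_ge by simp
qed

text \<open>The heights that remain after the first digit lie in [0,1), so the two integer digits
  differ by less than 1.\<close>

lemma height_eqD:
  assumes "x \<in> P" "y \<in> P" "height x = height y"
  shows "lab (ed x) = lab (ed y)" "height (T x) = height (T y)"
proof -
  have *: "real (lab (ed x)) + height (T x) = real (lab (ed y)) + height (T y)"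
    using height_step[OF assms(1)] height_step[OF assms(2)] assms(3) by simp
  have "\<bar>real (lab (ed x)) - real (lab (ed y))\<bar> < 1"
    using * height_nonneg[OF T_in[OF assms(1)]] height_nonneg[OF T_in[OF assms(2)]]
      height_less_1[OF T_in[OF assms(1)]] height_less_1[OF T_in[OF assms(2)]]
    by linarith
  then show eq: "lab (ed x) = lab (ed y)"
    by linarith
  then show "height (T x) = height (T y)"
    using * by simp
qed

text \<open>Equal heights give equal words of every length by \<open>height_eqD\<close>, and
  \<open>separated\<close> applies. Hence the points over one vertex are linearly ordered by height,
  without ties.\<close>

lemma height_inj:
  assumes "x \<in> P" "y \<in> P" "og (ed x) = og (ed y)" "height x = height y"
  shows "x = y"
proof (rule separated[OF assms(1-3)])
  fix i
  have "height ((T ^^ i) x) = height ((T ^^ i) y)"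
    by (induction i) (simp_all add: assms height_eqD T_pow_in)
  then show "lab (ed ((T ^^ i) x)) = lab (ed ((T ^^ i) y))"
    using assms by (intro height_eqD T_pow_in)
qed

lemma height_periodic:
  assumes "x \<in> P"
  shows "height ((T ^^ (n + per x)) x) = height ((T ^^ n) x)"
proof -
  have "lab (ed ((T ^^ i) ((T ^^ (n + per x)) x))) = lab (ed ((T ^^ i) ((T ^^ n) x)))" for i
    using lab_periodic[OF assms, of "i + n"] by (simp add: funpow_add add.assoc)
  then show ?thesis
    unfolding height_def by simp
qed

lemma height_mod:
  assumes "x \<in> P"
  shows "height ((T ^^ (n mod per x)) x) = height ((T ^^ n) x)"
proof -
  have "height ((T ^^ (m + q * per x)) x) = height ((T ^^ m) x)" for m q
  proof (induction q)
    case (Suc q)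
    then show ?case
      using height_periodic[OF assms, of "m + q * per x"] by (simp add: algebra_simps)
  qed simp
  from this[of "n mod per x" "n div per x"] show ?thesis
    by simp
qed

section \<open>Highest points and the cuts between them\<close>

definition top_verts :: "'p set \<Rightarrow> 'p set" where
  "top_verts C = {x \<in> C. \<forall>y\<in>C. og (ed y) = og (ed x) \<longrightarrow> height y \<le> height x}"

definition top_edges :: "'p set \<Rightarrow> 'p set" where
  "top_edges C = {x \<in> C. \<forall>y\<in>C. ed y = ed x \<longrightarrow> height y \<le> height x}"

text \<open>A point stands both for an arc and for the origin of that arc, so the ends of the arc
  \<open>x\<close> are \<open>x\<close> and \<open>T x\<close>. A cut is an end of a highest arc
  that is not highest over its own vertex.\<close>

definition cuts :: "'p set \<Rightarrow> 'p set" where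
  "cuts C = (top_edges C \<union> T ` top_edges C) - top_verts C"

lemma top_verts_edges: "top_verts C \<subseteq> top_edges C"
  by (auto simp: top_verts_def top_edges_def)

lemma top_verts_T_edges:
  assumes "C \<subseteq> P" "T ` C = C" "x \<in> C" "T x \<in> top_verts C"
  shows "x \<in> top_edges C"
  unfolding top_edges_def
proof (safe intro!: \<open>x \<in> C\<close>)
  fix y assume y: "y \<in> C" "ed y = ed x"
  with assms have "x \<in> P" "y \<in> P" "T y \<in> C"
    by auto
  then have "og (ed (T y)) = og (ed (T x))"
    using y tg_ed by metis
  with \<open>T y \<in> C\<close> have "height (T y) \<le> height (T x)"
    using assms(4) by (auto simp: top_verts_def)
  then show "height y \<le> height x"
    using height_T_le_iff[OF \<open>y \<in> P\<close> \<open>x \<in> P\<close>] y by simp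
qed

lemma card_top_verts:
  assumes "C \<subseteq> P"
  shows "card (top_verts C) = card (og ` ed ` C)"
    and "inj_on (\<lambda>x. og (ed x)) (top_verts C)"
proof -
  have "finite C"
    using assms finite_P by (rule finite_subset)
  then show "card (top_verts C) = card (og ` ed ` C)"
    unfolding top_verts_def image_image using assms height_inj
    by (intro card_fibre_maxima) auto
  show "inj_on (\<lambda>x. og (ed x)) (top_verts C)"
    unfolding top_verts_def using assms height_inj \<open>finite C\<close>
    by (intro card_fibre_maxima) auto
qed

lemma card_top_edges:
  assumes "C \<subseteq> P"
  shows "card (top_edges C) = card (ed ` C)"
  unfolding top_edges_def
proof (rule card_fibre_maxima)
  show "x = y" if "x \<in> C" "y \<in> C" "ed x = ed y" "height x = height y" for x y
    using that assms by (intro height_inj) auto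
qed (rule finite_subset[OF assms finite_P])

text \<open>
  A point that is highest over its vertex is also highest over the arcs before and after it, so the
  cuts come from the highest arcs in excess of the highest vertices.
\<close>

lemma card_cuts:
  assumes C: "C \<subseteq> P" "T ` C = C"
  shows "card (cuts C) \<le> 2 * (card (ed ` C) - card (og ` ed ` C))"
proof -
  have "finite C"
    using C finite_P by (auto intro: finite_subset)
  then have fin: "finite (top_edges C)" "finite (top_verts C)"
    by (auto simp: top_edges_def top_verts_def)
  have inj: "inj_on T (top_edges C)"
    by (rule inj_on_subset[OF T_inj]) (use C in \<open>auto simp: top_edges_def\<close>)
  have "top_verts C \<subseteq> T ` top_edges C"
  proof
    fix z assume z: "z \<in> top_verts C"
    then have "z \<in> T ` C"
      using C by (auto simp: top_verts_def)
    then obtain x where "x \<in> C" "z = T x"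
      by auto
    then show "z \<in> T ` top_edges C"
      using top_verts_T_edges[OF C, of x] z by auto
  qed
  then have 1: "card (T ` top_edges C - top_verts C) = card (ed ` C) - card (og ` ed ` C)"
    by (simp add: card_Diff_subset fin card_top_verts card_top_edges C(1) card_image[OF inj])
  have 2: "card (top_edges C - top_verts C) = card (ed ` C) - card (og ` ed ` C)"
    by (simp add: card_Diff_subset fin card_top_verts card_top_edges C(1) top_verts_edges)
  have "cuts C = (top_edges C - top_verts C) \<union> (T ` top_edges C - top_verts C)"
    by (auto simp: cuts_def)
  then show ?thesis
    using card_Un_le[of "top_edges C - top_verts C" "T ` top_edges C - top_verts C"] 1 2 by simp
qed

text \<open>Without cuts, both ends of a highest arc are highest. The property spreads backwards
  through \<open>top_verts_T_edges\<close>, and forwards because a point highest over its vertex is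
  also highest over its arc.\<close>

lemma run_without_cuts:
  assumes C: "C \<subseteq> P" "T ` C = C" "x \<in> C"
    and no_cut: "\<And>i. i < n \<Longrightarrow> (T ^^ i) x \<notin> cuts C"
    and j: "j < n" "(T ^^ j) x \<in> top_edges C"
    and i: "i < n"
  shows "(T ^^ i) x \<in> top_verts C"
proof -
  have in_C: "(T ^^ k) x \<in> C" for k
    using C by (induction k) auto
  have down: "(T ^^ k) x \<in> top_verts C" if "k + d = j" for k d
    using that
  proof (induction d arbitrary: k)
    case 0
    then show ?case
      using no_cut[of j] j by (auto simp: cuts_def)
  next
    case (Suc d)
    then have "T ((T ^^ k) x) \<in> top_verts C"
      using Suc.IH[of "Suc k"] by simp
    then have "(T ^^ k) x \<in> top_edges C"
      by (intro top_verts_T_edges[OF C(1,2)] in_C)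
    then show ?case
      using no_cut[of k] Suc.prems j by (auto simp: cuts_def)
  qed
  have up: "(T ^^ (j + d)) x \<in> top_verts C" if "j + d < n" for d
    using that
  proof (induction d)
    case 0
    then show ?case
      using down[of j 0] by simp
  next
    case (Suc d)
    then have "T ((T ^^ (j + d)) x) \<in> T ` top_edges C"
      using top_verts_edges by auto
    moreover have "T ((T ^^ (j + d)) x) \<notin> cuts C"
      using no_cut[of "j + Suc d"] Suc.prems by simp
    ultimately show ?case
      by (auto simp: cuts_def)
  qed
  show ?thesis
    using down[of i "j - i"] up[of "i - j"] i by (cases "i \<le> j") auto
qed

text \<open>Every vertex of \<open>P\<close> missed by \<open>C\<close> is the origin of an arc
  missed by \<open>C\<close>, so passing from \<open>C\<close> to \<open>P\<close> adds at least as
  many arcs as vertices.\<close>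

lemma rank_subset:
  assumes "C \<subseteq> P" "card (ed ` P) \<le> card (og ` ed ` P) + b"
  shows "card (ed ` C) \<le> card (og ` ed ` C) + b"
proof -
  let ?V = "og ` ed ` C" and ?E = "{e \<in> ed ` P. og e \<notin> og ` ed ` C}"
  have "finite (ed ` P)"
    using finite_P by simp
  have "og ` ed ` P = ?V \<union> og ` ?E"
    using assms(1) by blast
  then have "card (og ` ed ` P) \<le> card ?V + card (og ` ?E)"
    by (simp add: card_Un_le)
  also have "card (og ` ?E) \<le> card ?E"
    using \<open>finite (ed ` P)\<close> by (intro card_image_le) simp
  finally have "card (og ` ed ` P) \<le> card ?V + card ?E"
    by simp
  moreover have "card (ed ` C) + card ?E = card (ed ` C \<union> ?E)"
    using finite_subset[OF assms(1) finite_P] finite_P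
    by (intro card_Un_disjoint[symmetric]) auto
  moreover have "card (ed ` C \<union> ?E) \<le> card (ed ` P)"
    using assms(1) finite_P by (intro card_mono) auto
  ultimately show ?thesis
    using assms(2) by linarith
qed

section \<open>An arc covered exactly once\<close>

lemma ex_edge_covered_once:
  assumes "P \<noteq> {}" "1 \<le> b"
    and rank: "card (ed ` P) \<le> card (og ` ed ` P) + b"
    and long: "\<And>x. x \<in> P \<Longrightarrow> inj_on (\<lambda>i. (T ^^ i) x) {..<12 * b * per x}"
  shows "\<exists>x\<in>P. \<forall>y\<in>P. ed y = ed x \<longrightarrow> y = x"
proof -
  have "Max (per ` P) \<in> per ` P"
    using assms(1) finite_P by (intro Max_in) auto
  then obtain x0 where x0: "x0 \<in> P" "per x0 = Max (per ` P)"
    by auto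
  then have per_le: "per y \<le> per x0" if "y \<in> P" for y
    using that finite_P by simp
  define L where "L = per x0"
  have "L > 0"
    using per_pos[OF x0(1)] by (simp add: L_def)
  define C where "C = range (\<lambda>i. (T ^^ i) x0)"
  have C_sub: "C \<subseteq> P"
    using T_pow_in[OF x0(1)] by (auto simp: C_def)
  then have "finite C"
    using finite_P by (rule finite_subset)
  have "T ((T ^^ i) x0) \<in> C" for i
    unfolding C_def by (rule range_eqI[of _ _ "Suc i"]) simp
  then have "T ` C \<subseteq> C"
    by (auto simp: C_def)
  then have C_eq: "T ` C = C"
    using \<open>finite C\<close> inj_on_subset[OF T_inj C_sub] by (intro endo_inj_surj)
  \<comment> \<open>The branchings that \<open>C\<close> meets at its highest points. Each vertex
    carries at most one highest point, so \<open>card_branchings\<close> bounds the size of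
    \<open>D\<close> by \<open>b\<close>.\<close>
  define D where "D = {x \<in> top_verts C. \<exists>y\<in>P. og (ed y) = og (ed x) \<and> ed y \<noteq> ed x}"
  have "card D \<le> b"
  proof -
    have "inj_on (\<lambda>x. og (ed x)) D"
      by (rule inj_on_subset[OF card_top_verts(2)[OF C_sub]]) (auto simp: D_def)
    then have "card D = card ((\<lambda>x. og (ed x)) ` D)"
      by (simp add: card_image)
    also have "card (og ` ed ` P) + \<dots> \<le> card (ed ` P)"
    proof (rule card_branchings)
      have "D \<subseteq> P"
        using C_sub by (auto simp: D_def top_verts_def)
      then show "(\<lambda>x. og (ed x)) ` D \<subseteq> og ` ed ` P"
        by auto
      fix v assume "v \<in> (\<lambda>x. og (ed x)) ` D"
      with \<open>D \<subseteq> P\<close> show "\<exists>e\<in>ed ` P. \<exists>e'\<in>ed ` P. e \<noteq> e' \<and> og e = v \<and> og e' = v"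
        by (fastforce simp: D_def)
    qed (use finite_P in auto)
    finally show ?thesis
      using rank by linarith
  qed
  define Z where "Z = cuts C \<union> D"
  have "finite Z"
    using \<open>finite C\<close> by (auto simp: Z_def cuts_def D_def top_edges_def top_verts_def)
  have "card Z \<le> 3 * b"
    using card_Un_le[of "cuts C" D] \<open>card D \<le> b\<close> card_cuts[OF C_sub C_eq] rank_subset[OF C_sub rank]
    unfolding Z_def by linarith
  \<comment> \<open>There are \<open>6 * b\<close> windows of length \<open>2 * L\<close> and at
    most \<open>3 * b\<close> points in \<open>Z\<close>. By \<open>long\<close>, points in
    different windows are distinct, so some window misses \<open>Z\<close>.\<close>
  have "\<exists>j<6 * b. \<forall>i<2 * L. (T ^^ (2 * L * j + i)) x0 \<notin> Z"
  proof (rule ccontr)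
    assume "\<not> ?thesis"
    then have "\<forall>j<6 * b. \<exists>i<2 * L. (T ^^ (2 * L * j + i)) x0 \<in> Z"
      by auto
    then obtain n where n: "\<And>j. j < 6 * b \<Longrightarrow> n j < 2 * L \<and> (T ^^ (2 * L * j + n j)) x0 \<in> Z"
      by metis
    have bound: "2 * L * j + n j < 12 * b * per x0" if "j < 6 * b" for j
    proof -
      have "2 * L * j + n j < 2 * L * j + 2 * L"
        using n[OF that] by simp
      also have "\<dots> = 2 * L * Suc j"
        by simp
      also have "\<dots> \<le> 2 * L * (6 * b)"
        using that by (intro mult_le_mono2) simp
      finally show ?thesis
        by (simp add: L_def mult_ac)
    qed
    have "inj_on (\<lambda>j. (T ^^ (2 * L * j + n j)) x0) {..<6 * b}"
    proof (rule inj_onI)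
      fix j j' assume j: "j \<in> {..<6 * b}" "j' \<in> {..<6 * b}"
        and "(T ^^ (2 * L * j + n j)) x0 = (T ^^ (2 * L * j' + n j')) x0"
      then have "2 * L * j + n j = 2 * L * j' + n j'"
        using long[OF x0(1)] bound by (auto dest: inj_onD)
      then have "(2 * L * j + n j) div (2 * L) = (2 * L * j' + n j') div (2 * L)"
        by simp
      then show "j = j'"
        using n j \<open>L > 0\<close> by simp
    qed
    then have "6 * b \<le> card Z"
      using card_inj_on_le[of _ "{..<6 * b}" Z] n \<open>finite Z\<close> by auto
    then show False
      using \<open>card Z \<le> 3 * b\<close> \<open>1 \<le> b\<close> by simp
  qed
  then obtain j where j: "\<And>i. i < 2 * L \<Longrightarrow> (T ^^ (2 * L * j + i)) x0 \<notin> Z"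
    by auto
  define x where "x = (T ^^ (2 * L * j)) x0"
  have x_in: "x \<in> C" "x \<in> P"
    using C_sub by (auto simp: x_def C_def)
  have x_pow: "(T ^^ i) x = (T ^^ (2 * L * j + i)) x0" for i
    by (simp add: x_def funpow_add[of i] add.commute)
  have no_Z: "(T ^^ i) x \<notin> Z" if "i < 2 * L" for i
    using j[OF that] by (simp add: x_pow)
  have "Max (height ` C) \<in> height ` C"
    using \<open>finite C\<close> x_in by (intro Max_in) auto
  then obtain m where m: "height ((T ^^ m) x0) = Max (height ` C)"
    by (auto simp: C_def)
  \<comment> \<open>The window starts at a multiple of \<open>L\<close>, and \<open>L\<close> is a
    period of the heights along \<open>C\<close>, so a position of maximal height recurs at offset
    \<open>m mod L\<close>.\<close>
  define k where "k = m mod L"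
  have "k < L"
    using \<open>L > 0\<close> by (simp add: k_def)
  have "2 * L * j + k = k + L * (2 * j)"
    by simp
  then have "(2 * L * j + k) mod L = m mod L"
    by (simp only: mod_mult_self2) (simp add: k_def)
  then have "height ((T ^^ k) x) = Max (height ` C)"
    using m height_mod[OF x0(1), of "2 * L * j + k"] height_mod[OF x0(1), of m]
    by (simp add: x_pow L_def)
  moreover have "(T ^^ k) x \<in> C"
    by (simp add: x_pow C_def)
  ultimately have "(T ^^ k) x \<in> top_edges C"
    using \<open>finite C\<close> by (auto simp: top_edges_def)
  then have top: "(T ^^ i) x \<in> top_verts C" if "i < 2 * L" for i
    using run_without_cuts[OF C_sub C_eq x_in(1), of "2 * L" k i] no_Z \<open>k < L\<close> that
    by (auto simp: Z_def)
  show ?thesis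
  proof (intro bexI[OF _ x_in(2)] ballI impI)
    fix y assume y: "y \<in> P" "ed y = ed x"
    \<comment> \<open>At a highest point outside \<open>D\<close> only one arc of the family leaves
      the vertex, so \<open>y\<close> cannot part from \<open>x\<close> within the window.\<close>
    have same: "ed ((T ^^ i) y) = ed ((T ^^ i) x)" if "i < 2 * L" for i
      using that
    proof (induction i)
      case 0
      then show ?case
        using y by simp
    next
      case (Suc i)
      then have "og (ed ((T ^^ Suc i) y)) = og (ed ((T ^^ Suc i) x))"
        using tg_ed[OF T_pow_in[OF y(1), of i]] tg_ed[OF T_pow_in[OF x_in(2), of i]] by simp
      moreover have "(T ^^ Suc i) x \<notin> D" "(T ^^ Suc i) x \<in> top_verts C"
        using no_Z[OF Suc.prems] top[OF Suc.prems] by (auto simp: Z_def)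
      ultimately show ?case
        using T_pow_in[OF y(1), of "Suc i"] unfolding D_def by blast
    qed
    \<comment> \<open>\<open>separated\<close> asks for \<open>per x + per y\<close> equal labels;
      \<open>2 * L\<close> suffice because \<open>L\<close> is the largest period.\<close>
    have "per x = L"
      by (simp add: x_def per_T_pow x0 L_def)
    then show "y = x"
      using y x_in per_le[OF y(1)] same
      by (intro separated) (auto simp: L_def)
  qed
qed

end

section \<open>Independent cycles\<close>

lemma lookup_scale: "Poly_Mapping.lookup (Poly_Mapping.map ((*) r) c) e = r * Poly_Mapping.lookup c e"
  for c :: "'b \<Rightarrow>\<^sub>0 real"
  by (simp add: Poly_Mapping.map.rep_eq when_def)

text \<open>The scalar multiplication is the one in \<open>betti1\<close>, so independence in this
  vector space is the very condition counted there.\<close>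

interpretation chains: vector_space "\<lambda>r. Poly_Mapping.map ((*) r) :: ('b \<Rightarrow>\<^sub>0 real) \<Rightarrow> _"
  by standard (rule poly_mapping_eqI, simp add: lookup_scale lookup_add algebra_simps)+

text \<open>Project along some \<open>b\<close> with \<open>\<phi> b \<noteq> 0\<close> onto the
  kernel of \<open>\<phi>\<close>. The projected vectors together with \<open>b\<close> still span
  \<open>B\<close>, so a maximal independent subset of them has lost at most one element.\<close>

lemma (in vector_space) independent_in_kernel:
  assumes "independent B" "finite B"
    and add: "\<And>x y. \<phi> (x + y) = \<phi> x + \<phi> y" and scale: "\<And>r x. \<phi> (scale r x) = r * \<phi> x"
  shows "\<exists>M. M \<subseteq> span B \<and> independent M \<and> finite M \<and> card B \<le> card M + 1 \<and> (\<forall>x\<in>M. \<phi> x = 0)"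
proof (cases "\<forall>x\<in>B. \<phi> x = 0")
  case True
  then show ?thesis
    using assms(1,2) by (intro exI[of _ B]) (auto simp: span_base)
next
  case False
  then obtain b where b: "b \<in> B" "\<phi> b \<noteq> 0"
    by auto
  define g where "g x = x + scale (- (\<phi> x / \<phi> b)) b" for x
  have \<phi>_g: "\<phi> (g x) = 0" for x
    unfolding g_def add scale using b by simp
  obtain M where M: "M \<subseteq> g ` B" "independent M" "g ` B \<subseteq> span M"
    using maximal_independent_subset by metis
  have "finite M"
    using M(1) \<open>finite B\<close> by (auto intro: finite_subset)
  have "g ` B \<subseteq> span B"
  proof
    fix y assume "y \<in> g ` B"
    then show "y \<in> span B"
      using b unfolding g_def by (blast intro: span_add span_scale span_base)
  qed
  have "x \<in> span (insert b M)" if "x \<in> B" for x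
  proof -
    have "g x \<in> span (insert b M)"
      using M(3) that span_mono[of M "insert b M"] by auto
    then have "g x + scale (\<phi> x / \<phi> b) b \<in> span (insert b M)"
      by (intro span_add[OF _ span_scale[OF span_base]]) auto
    then show ?thesis
      by (simp add: g_def)
  qed
  then have "card B \<le> card (insert b M)"
    using independent_span_bound[of "insert b M" B] \<open>finite M\<close> assms(1) by auto
  also have "\<dots> \<le> card M + 1"
    using \<open>finite M\<close> by (simp add: card_insert_if)
  finally show ?thesis
    using M \<open>g ` B \<subseteq> span B\<close> \<open>finite M\<close> \<phi>_g by (intro exI[of _ M]) auto
qed

text \<open>Induction over the functionals, each costing at most one dimension. Staying inside
  \<open>span M\<close> keeps the functionals treated before equal to zero.\<close>

lemma (in vector_space) independent_in_kernels:
  assumes "finite V" "independent B" "finite B"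
    and add: "\<And>v x y. \<phi> v (x + y) = \<phi> v x + \<phi> v y" and scale: "\<And>v r x. \<phi> v (scale r x) = r * \<phi> v x"
  shows "\<exists>M. M \<subseteq> span B \<and> independent M \<and> finite M \<and> card B \<le> card M + card V \<and>
    (\<forall>v\<in>V. \<forall>x\<in>M. \<phi> v x = 0)"
  using assms(1)
proof (induction V)
  case empty
  then show ?case
    using assms(2,3) by (intro exI[of _ B]) (auto simp: span_base)
next
  case (insert v V)
  then obtain M where M: "M \<subseteq> span B" "independent M" "finite M" "card B \<le> card M + card V"
    "\<forall>v\<in>V. \<forall>x\<in>M. \<phi> v x = 0"
    by auto
  obtain N where N: "N \<subseteq> span M" "independent N" "finite N" "card M \<le> card N + 1" "\<forall>x\<in>N. \<phi> v x = 0"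
    using independent_in_kernel[OF M(2,3), of "\<phi> v"] add scale by auto
  have "\<phi> u x = 0" if "u \<in> V" "x \<in> span M" for u x
    using that(2)
  proof (induction rule: span_induct_alt)
    case base
    then show ?case
      using scale[of u 0 0] by simp
  next
    case (step c x y)
    then show ?case
      using M(5) that(1) by (simp add: add scale)
  qed
  moreover have "N \<subseteq> span B"
    using N(1) span_mono[OF M(1)] by (auto simp: span_span)
  ultimately show ?case
    using N M(4) insert.hyps by (intro exI[of _ N]) auto
qed

lemma boundary_superset:
  assumes "finite A" "Poly_Mapping.keys c \<subseteq> A"
  shows "boundary G c = (\<Sum>e\<in>A. Poly_Mapping.single (head G e) (Poly_Mapping.lookup c e) -
    Poly_Mapping.single (tail G e) (Poly_Mapping.lookup c e))"
  unfolding boundary_def using assms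
  by (intro sum.mono_neutral_left) (auto simp: in_keys_iff)

lemma boundary_add: "boundary G (c + d) = boundary G c + boundary G d"
proof -
  let ?A = "Poly_Mapping.keys c \<union> Poly_Mapping.keys d"
  show ?thesis
    using boundary_superset[of ?A c G] boundary_superset[of ?A d G]
      boundary_superset[of ?A "c + d" G] Poly_Mapping.keys_add[of c d]
    by (simp add: lookup_add single_add algebra_simps flip: sum.distrib)
qed

lemma boundary_sum: "boundary G (sum f I) = (\<Sum>i\<in>I. boundary G (f i))"
proof (induction I rule: infinite_finite_induct)
  case (insert i I)
  then show ?case
    by (simp add: boundary_add)
qed (simp_all add: boundary_def)

lemma boundary_single:
  "boundary G (Poly_Mapping.single e r) = Poly_Mapping.single (head G e) r - Poly_Mapping.single (tail G e) r"
  using boundary_superset[of "{e}" "Poly_Mapping.single e r" G] by simp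

lemma boundary_scale:
  "boundary G (Poly_Mapping.map ((*) r) c) = Poly_Mapping.map ((*) r) (boundary G c)"
proof (rule poly_mapping_eqI)
  fix v
  have "Poly_Mapping.keys (Poly_Mapping.map ((*) r) c) \<subseteq> Poly_Mapping.keys c"
    by (auto simp: in_keys_iff lookup_scale)
  then show "Poly_Mapping.lookup (boundary G (Poly_Mapping.map ((*) r) c)) v =
    Poly_Mapping.lookup (Poly_Mapping.map ((*) r) (boundary G c)) v"
    by (simp add: boundary_superset[of "Poly_Mapping.keys c"] boundary_superset[of "Poly_Mapping.keys c" c]
        lookup_scale lookup_sum lookup_minus lookup_single sum_distrib_left right_diff_distrib mult_when)
qed

section \<open>Lower bounds for the Betti number\<close>

lemma betti1_ge_independent:
  assumes "finite B" "B \<subseteq> cycle_space G" "chains.independent B"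
  shows "enat (card B) \<le> betti1 G"
  unfolding betti1_def using assms by (intro Sup_upper) auto

text \<open>The arcs of \<open>E\<close> span a space of dimension \<open>card E\<close>, on which
  each vertex of \<open>V\<close> imposes one linear condition: the boundary has coefficient 0
  there. At other vertices this is automatic, since no arc of \<open>E\<close> touches them.\<close>

lemma betti1_ge_arcs_minus_verts:
  assumes "finite E" "E \<subseteq> arcs G" "finite V" "tail G ` E \<subseteq> V" "head G ` E \<subseteq> V"
  shows "enat (card E - card V) \<le> betti1 G"
proof -
  let ?\<delta> = "\<lambda>e. Poly_Mapping.single e (1::real)"
  have inj: "inj ?\<delta>"
  proof (rule injI)
    fix e e' assume "?\<delta> e = ?\<delta> e'"
    then have "Poly_Mapping.keys (?\<delta> e) = Poly_Mapping.keys (?\<delta> e')"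
      by simp
    then show "e = e'"
      by simp
  qed
  have "chains.independent (?\<delta> ` E)"
  proof (rule chains.independent_if_scalars_zero)
    show "finite (?\<delta> ` E)"
      using \<open>finite E\<close> by simp
    fix f x assume sum: "(\<Sum>x\<in>?\<delta> ` E. Poly_Mapping.map ((*) (f x)) x) = 0" and "x \<in> ?\<delta> ` E"
    then obtain e where e: "e \<in> E" "x = ?\<delta> e"
      by auto
    have "Poly_Mapping.lookup (\<Sum>x\<in>?\<delta> ` E. Poly_Mapping.map ((*) (f x)) x) e = 
      (\<Sum>e'\<in>E. f (?\<delta> e') when e' = e)"
      by (subst sum.reindex[OF inj_on_subset[OF inj]])
        (auto simp: lookup_sum lookup_scale lookup_single when_def intro!: sum.cong)
    also have "\<dots> = f x"
      using e \<open>finite E\<close> by (simp add: when_def)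
    finally show "f x = 0"
      using sum by simp
  qed
  then obtain M where M: "M \<subseteq> chains.span (?\<delta> ` E)" "chains.independent M" "finite M"
    "card (?\<delta> ` E) \<le> card M + card V" "\<forall>v\<in>V. \<forall>x\<in>M. Poly_Mapping.lookup (boundary G x) v = 0"
    using chains.independent_in_kernels[OF \<open>finite V\<close>, of "?\<delta> ` E" "\<lambda>v c. Poly_Mapping.lookup (boundary G c) v"]
      \<open>finite E\<close> by (auto simp: boundary_add boundary_scale lookup_add lookup_scale)
  have keys: "Poly_Mapping.keys c \<subseteq> E" if "c \<in> chains.span (?\<delta> ` E)" for c
    using that
  proof (induction rule: chains.span_induct_alt)
    case (step r x y)
    then show ?case
      by (auto simp: in_keys_iff lookup_add lookup_scale lookup_single when_def split: if_splits)
  qed simp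
  have "M \<subseteq> cycle_space G"
  proof
    fix c assume "c \<in> M"
    then have c: "Poly_Mapping.keys c \<subseteq> E"
      using M(1) keys by auto
    have "Poly_Mapping.lookup (boundary G c) v = 0" for v
    proof (cases "v \<in> V")
      case False
      then have "head G e \<noteq> v \<and> tail G e \<noteq> v" if "e \<in> E" for e
        using that assms by auto
      then show ?thesis
        by (auto simp: boundary_superset[OF \<open>finite E\<close> c] lookup_sum lookup_minus lookup_single when_def intro!: sum.neutral)
    qed (use M \<open>c \<in> M\<close> in auto)
    then have "boundary G c = 0"
      by (intro poly_mapping_eqI) simp
    then show "c \<in> cycle_space G"
      using c assms(2) by (auto simp: cycle_space_def)
  qed
  then have "enat (card M) \<le> betti1 G"
    using M by (intro betti1_ge_independent)
  moreover have "card (?\<delta> ` E) = card E"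
    by (rule card_image[OF inj_on_subset[OF inj]]) simp
  ultimately show ?thesis
    using M(4) by (auto intro: order_trans[rotated])
qed

text \<open>In a vanishing linear combination let \<open>Y\<close> collect the members with nonzero
  coefficient; at the private arc of one of them only its own term survives. Two-element families
  \<open>Y\<close> show that \<open>c\<close> is injective, so the image is as large as
  \<open>X\<close>.\<close>

lemma betti1_ge_card_chains:
  assumes "finite X" "\<And>C. C \<in> X \<Longrightarrow> c C \<in> cycle_space G"
    and private_arc: "\<And>Y. Y \<subseteq> X \<Longrightarrow> Y \<noteq> {} \<Longrightarrow> \<exists>C\<in>Y. \<exists>e. Poly_Mapping.lookup (c C) e \<noteq> 0 \<and>
      (\<forall>C'\<in>Y - {C}. Poly_Mapping.lookup (c C') e = 0)"
  shows "enat (card X) \<le> betti1 G"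
proof -
  have inj: "inj_on c X"
  proof (rule inj_onI, rule ccontr)
    fix C C' assume C: "C \<in> X" "C' \<in> X" "c C = c C'" "C \<noteq> C'"
    then obtain D e where D: "D = C \<or> D = C'" "Poly_Mapping.lookup (c D) e \<noteq> 0"
      and "\<forall>C''\<in>{C, C'} - {D}. Poly_Mapping.lookup (c C'') e = 0"
      using private_arc[of "{C, C'}"] by auto
    then have "Poly_Mapping.lookup (c C') e = 0 \<or> Poly_Mapping.lookup (c C) e = 0"
      using C(4) by blast
    then show False
      using C(3) D by auto
  qed
  have "chains.independent (c ` X)"
  proof (rule chains.independent_if_scalars_zero)
    show "finite (c ` X)"
      using assms(1) by simp
    fix f x assume sum: "(\<Sum>x\<in>c ` X. Poly_Mapping.map ((*) (f x)) x) = 0" and x: "x \<in> c ` X"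
    show "f x = 0"
    proof (rule ccontr)
      assume "f x \<noteq> 0"
      define Y where "Y = {C \<in> X. f (c C) \<noteq> 0}"
      have "Y \<subseteq> X" "Y \<noteq> {}"
        using x \<open>f x \<noteq> 0\<close> by (auto simp: Y_def)
      from private_arc[OF this] obtain C e where C: "C \<in> Y" "Poly_Mapping.lookup (c C) e \<noteq> 0"
        "\<And>C'. C' \<in> Y - {C} \<Longrightarrow> Poly_Mapping.lookup (c C') e = 0"
        by auto
      have "0 = Poly_Mapping.lookup (\<Sum>C\<in>X. Poly_Mapping.map ((*) (f (c C))) (c C)) e"
        using sum by (simp add: sum.reindex[OF inj])
      also have "\<dots> = (\<Sum>C'\<in>X. f (c C') * Poly_Mapping.lookup (c C') e)"
        by (simp add: lookup_sum lookup_scale)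
      also have "\<dots> = (\<Sum>C'\<in>{C}. f (c C') * Poly_Mapping.lookup (c C') e)"
        using C assms(1) by (intro sum.mono_neutral_right) (auto simp: Y_def)
      also have "\<dots> \<noteq> 0"
        using C by (simp add: Y_def)
      finally show False
        by simp
    qed
  qed
  then have "enat (card (c ` X)) \<le> betti1 G"
    using assms by (intro betti1_ge_independent) auto
  then show ?thesis
    by (simp add: card_image[OF inj])
qed

section \<open>Components and parametrised circles\<close>

definition sym_arcs :: "('a, 'b) pre_digraph \<Rightarrow> ('a \<times> 'a) set" where
  "sym_arcs G = (\<Union>e\<in>arcs G. {(tail G e, head G e), (head G e, tail G e)})"

lemma sym_arcsI:
  assumes "e \<in> arcs G"
  shows "(tail G e, head G e) \<in> sym_arcs G" "(head G e, tail G e) \<in> sym_arcs G"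
  using assms by (auto simp: sym_arcs_def)

lemma sym_sym_arcs: "sym (sym_arcs G)"
  by (auto simp: sym_arcs_def sym_def)

lemma connected_iff_sym_arcs:
  assumes "wf_digraph G"
  shows "connected G \<longleftrightarrow> verts G \<noteq> {} \<and> (\<forall>u\<in>verts G. \<forall>v\<in>verts G. (u, v) \<in> (sym_arcs G)\<^sup>*)"
proof -
  interpret wf_digraph G
    by fact
  interpret S: pair_wf_digraph "mk_symmetric G"
    by (rule wellformed_mk_symmetric)
  have "u \<rightarrow>\<^sup>*\<^bsub>mk_symmetric G\<^esub> v \<longleftrightarrow> (u, v) \<in> (sym_arcs G)\<^sup>*" if "u \<in> verts G" for u v
    using S.reachable_conv'[of u v] that by (simp add: parcs_mk_symmetric sym_arcs_def)
  then show ?thesis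
    by (auto simp: connected_def strongly_connected_def)
qed

definition component_of :: "('a, 'b) pre_digraph \<Rightarrow> 'a \<Rightarrow> ('a, 'b) pre_digraph" where
  "component_of G v = G \<restriction> {w. (v, w) \<in> (sym_arcs G)\<^sup>*}"

context wf_digraph
begin

lemma sym_arcs_rtrancl_verts: "(v, w) \<in> (sym_arcs G)\<^sup>* \<Longrightarrow> v \<in> verts G \<Longrightarrow> w \<in> verts G"
  by (induction rule: rtrancl_induct) (auto simp: sym_arcs_def)

lemma component_of_simps:
  "verts (component_of G v) = {w. (v, w) \<in> (sym_arcs G)\<^sup>*}"
  "tail (component_of G v) = tail G" "head (component_of G v) = head G"
  by (simp_all add: component_of_def)

lemma arcs_component_of:
  assumes "e \<in> arcs G"
  shows "e \<in> arcs (component_of G v) \<longleftrightarrow> (v, tail G e) \<in> (sym_arcs G)\<^sup>*"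
    and "e \<in> arcs (component_of G v) \<longleftrightarrow> (v, head G e) \<in> (sym_arcs G)\<^sup>*"
  using sym_arcsI[OF assms] assms
  by (auto simp: component_of_def intro: rtrancl_into_rtrancl)

lemma component_of_subgraph:
  assumes "v \<in> verts G"
  shows "subgraph (component_of G v) G"
  unfolding component_of_def
  using sym_arcs_rtrancl_verts[OF _ assms] by (intro subgraph_induce_subgraphI) auto

lemma component_of_connected:
  assumes v: "v \<in> verts G"
  shows "connected (component_of G v)"
proof -
  let ?H = "component_of G v"
  have "wf_digraph ?H"
    using component_of_subgraph[OF v] by auto
  have from_v: "(v, w) \<in> (sym_arcs ?H)\<^sup>*" if "(v, w) \<in> (sym_arcs G)\<^sup>*" for w
    using that
  proof (induction rule: rtrancl_induct)
    case (step x y)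
    from step(2) obtain e where "e \<in> arcs G" "(x, y) \<in> {(tail G e, head G e), (head G e, tail G e)}"
      by (auto simp: sym_arcs_def)
    with step(1) have "(x, y) \<in> sym_arcs ?H"
      using arcs_component_of[of e v] sym_arcsI[of e ?H] by (auto simp: component_of_simps)
    with step(3) show ?case
      by (rule rtrancl_into_rtrancl)
  qed simp
  have "(x, y) \<in> (sym_arcs ?H)\<^sup>*" if "x \<in> verts ?H" "y \<in> verts ?H" for x y
    using that from_v[of x] from_v[of y] sym_rtrancl[OF sym_sym_arcs[of ?H]]
    by (auto simp: component_of_simps dest: symD intro: rtrancl_trans)
  then show ?thesis
    unfolding connected_iff_sym_arcs[OF \<open>wf_digraph ?H\<close>] by (auto simp: component_of_simps)
qed

lemma connected_subgraph_component_of: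
  assumes "subgraph H G" "connected H" "v \<in> verts H"
  shows "subgraph H (component_of G v)"
proof -
  have H: "wf_digraph H" "verts H \<subseteq> verts G" "arcs H \<subseteq> arcs G" "tail H = tail G" "head H = head G"
    using assms(1) by (auto simp: subgraph_def compatible_def)
  have "sym_arcs H \<subseteq> sym_arcs G"
    using H by (auto simp: sym_arcs_def)
  then have "verts H \<subseteq> verts (component_of G v)"
    using assms(2,3) rtrancl_mono[of "sym_arcs H" "sym_arcs G"]
    unfolding connected_iff_sym_arcs[OF H(1)] by (auto simp: component_of_simps)
  moreover have "arcs H \<subseteq> arcs (component_of G v)"
  proof
    fix e assume "e \<in> arcs H"
    then have "tail G e \<in> verts H"
      using wf_digraph.tail_in_verts[OF H(1), of e] H by simp
    then show "e \<in> arcs (component_of G v)"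
      using calculation H \<open>e \<in> arcs H\<close> arcs_component_of(1)[of e v] by (auto simp: component_of_simps)
  qed
  ultimately show ?thesis
    using H component_of_subgraph[of v] assms(3) by (auto simp: subgraph_def compatible_def)
qed

text \<open>The class of a vertex is connected by \<open>component_of_connected\<close> and contains
  every connected subgraph through that vertex by
  \<open>connected_subgraph_component_of\<close>.\<close>

lemma components_iff: "C \<in> components G \<longleftrightarrow> (\<exists>v\<in>verts G. C = component_of G v)"
proof
  assume "C \<in> components G"
  then have C: "subgraph C G" "connected C"
    and max: "\<And>H. H \<noteq> C \<Longrightarrow> subgraph C H \<Longrightarrow> \<not> (subgraph H G \<and> connected H)"
    by (auto simp: components_def max_subgraph_def)
  have "wf_digraph C"
    using C by auto
  then obtain v where v: "v \<in> verts C"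
    using C connected_iff_sym_arcs by blast
  have "v \<in> verts G"
    using C v by auto
  then show "\<exists>v\<in>verts G. C = component_of G v"
    using max[of "component_of G v"] connected_subgraph_component_of[OF C v]
      component_of_subgraph component_of_connected by blast
next
  assume "\<exists>v\<in>verts G. C = component_of G v"
  then obtain v where v: "v \<in> verts G" "C = component_of G v"
    by auto
  show "C \<in> components G"
    unfolding components_def max_subgraph_def
  proof (safe)
    show "subgraph C G" "connected C"
      using v component_of_subgraph component_of_connected by auto
    fix H assume H: "H \<noteq> C" "subgraph C H" "subgraph H G" "connected H"
    have "v \<in> verts C"
      using v by (simp add: component_of_simps)
    then have "v \<in> verts H"
      using H(2) by auto
    then have "subgraph H C"
      using connected_subgraph_component_of[OF H(3,4)] v by simp
    then have "H = C"
      using H(2) by (auto simp: subgraph_def compatible_def intro!: pre_digraph.equality)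
    then show False
      using H(1) by simp
  qed
qed

lemma component_of_eq:
  assumes "C \<in> components G" "v \<in> verts C"
  shows "component_of G v = C"
proof -
  obtain u where u: "u \<in> verts G" "C = component_of G u"
    using assms(1) by (auto simp: components_iff)
  then have "(u, v) \<in> (sym_arcs G)\<^sup>*"
    using assms(2) by (simp add: component_of_simps)
  then have "(v, u) \<in> (sym_arcs G)\<^sup>*"
    by (rule symD[OF sym_rtrancl[OF sym_sym_arcs]])
  then have "{w. (v, w) \<in> (sym_arcs G)\<^sup>*} = {w. (u, w) \<in> (sym_arcs G)\<^sup>*}"
    using \<open>(u, v) \<in> (sym_arcs G)\<^sup>*\<close> by (auto intro: rtrancl_trans)
  then show ?thesis
    by (simp add: u component_of_def)
qed

lemma components_subgraph: "C \<in> components G \<Longrightarrow> subgraph C G"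
  by (auto simp: components_iff component_of_subgraph)

lemma components_arc_closed:
  assumes "C \<in> components G" "e \<in> arcs G" "tail G e \<in> verts C \<or> head G e \<in> verts C"
  shows "e \<in> arcs C"
  using assms arcs_component_of[OF assms(2)] by (auto simp: components_iff component_of_simps)

lemma components_tail_head:
  assumes "C \<in> components G"
  shows "tail C = tail G" "head C = head G"
  using components_subgraph[OF assms] by (auto simp: subgraph_def compatible_def)

lemma components_disjoint:
  assumes "C \<in> components G" "C' \<in> components G" "e \<in> arcs C" "e \<in> arcs C'"
  shows "C = C'"
proof -
  have "tail G e \<in> verts H" if "H \<in> components G" "e \<in> arcs H" for H
    using components_subgraph[OF that(1)] wf_digraph.tail_in_verts[of H e] that components_tail_head[OF that(1)]
    by (simp add: subgraph_def)
  then show ?thesis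
    using component_of_eq[OF assms(1), of "tail G e"] component_of_eq[OF assms(2), of "tail G e"] assms by simp
qed

end

text \<open>Both indexings run over all natural numbers with period \<open>k\<close>, like a
  half-line wound around the circle, so changing the starting point and walking on need no reduction
  modulo \<open>k\<close>.\<close>

definition circle_param :: "('a, 'b) pre_digraph \<Rightarrow> nat \<Rightarrow> (nat \<Rightarrow> 'a) \<Rightarrow> (nat \<Rightarrow> 'b) \<Rightarrow> bool" where
  "circle_param C k v e \<longleftrightarrow> 0 < k \<and> range v = verts C \<and> range e = arcs C \<and>
     (\<forall>i j. v i = v j \<longleftrightarrow> [i = j] (mod k)) \<and> (\<forall>i j. e i = e j \<longleftrightarrow> [i = j] (mod k)) \<and>
     (\<forall>i. tail C (e i) = v i \<and> head C (e i) = v (Suc i))"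

lemma circle_simps [simp]:
  "verts (circle k) = {..<k}" "arcs (circle k) = {..<k}"
  "tail (circle k) i = i" "head (circle k) i = Suc i mod k"
  by (simp_all add: circle_def)

lemma is_circle_param:
  assumes "is_circle C"
  shows "\<exists>k v e. circle_param C k v e"
proof -
  obtain k f where k: "k \<ge> 1" "pre_digraph.digraph_isomorphism (circle k) f" "C = app_iso f (circle k)"
    using assms by (auto simp: is_circle_def digraph_iso_def)
  define v where "v = (\<lambda>i. iso_verts f (i mod k))"
  define e where "e = (\<lambda>i. iso_arcs f (i mod k))"
  have inj: "inj_on (iso_verts f) {..<k}" "inj_on (iso_arcs f) {..<k}"
    using k(2) by (simp_all add: pre_digraph.digraph_isomorphism_def)
  have iso: "iso_tail f (iso_arcs f i) = iso_verts f i" "iso_head f (iso_arcs f i) = iso_verts f (Suc i mod k)"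
    if "i < k" for i
    using k(2) that unfolding pre_digraph.digraph_isomorphism_def by (metis circle_simps lessThan_iff)+
  have range_mod: "range (\<lambda>i. i mod k) = {..<k}"
    using k(1) by (auto simp: image_iff) (metis mod_less)
  have "circle_param C k v e"
    unfolding circle_param_def
  proof (intro conjI allI)
    show "range v = verts C"
      using image_image[of "iso_verts f" "\<lambda>i. i mod k" UNIV] by (simp add: v_def k(3) range_mod)
    show "range e = arcs C"
      using image_image[of "iso_arcs f" "\<lambda>i. i mod k" UNIV] by (simp add: e_def k(3) range_mod)
    show "v i = v j \<longleftrightarrow> [i = j] (mod k)" for i j
      using inj_on_eq_iff[OF inj(1), of "i mod k" "j mod k"] k(1) by (simp add: v_def cong_def)
    show "e i = e j \<longleftrightarrow> [i = j] (mod k)" for i j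
      using inj_on_eq_iff[OF inj(2), of "i mod k" "j mod k"] k(1) by (simp add: e_def cong_def)
    show "tail C (e i) = v i" "head C (e i) = v (Suc i)" for i
      using k(1,3) iso[of "i mod k"] by (simp_all add: v_def e_def mod_Suc_eq)
  qed (use k in simp)
  then show ?thesis
    by blast
qed

lemma range_shift:
  assumes "0 < k" "\<And>i j :: nat. [i = j] (mod k) \<Longrightarrow> f i = f j"
  shows "range (\<lambda>i. f (i + n)) = range f"
proof -
  have "f i = f (i + n * (k - 1) + n)" for i
  proof (rule assms(2))
    obtain m where "k = Suc m"
      using \<open>0 < k\<close> gr0_implies_Suc by blast
    then have "i + n * (k - 1) + n = i + n * k"
      by simp
    then show "[i = i + n * (k - 1) + n] (mod k)"
      by (simp only: cong_def mod_mult_self1)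
  qed
  then show ?thesis
    by blast
qed

lemma circle_param_shift:
  assumes "circle_param C k v e"
  shows "circle_param C k (\<lambda>i. v (i + n)) (\<lambda>i. e (i + n))"
proof -
  have "range (\<lambda>i. v (i + n)) = range v" "range (\<lambda>i. e (i + n)) = range e"
    using assms unfolding circle_param_def by (intro range_shift[of k]; blast)+
  then show ?thesis
    using assms by (simp add: circle_param_def cong_add_rcancel_nat)
qed

lemma circle_param_card:
  assumes "circle_param C k v e"
  shows "finite (verts C)" "card (verts C) = k" "arcs C = e ` {..<k}" "inj_on e {..<k}" "finite (arcs C)"
proof -
  have "k > 0"
    using assms by (simp add: circle_param_def)
  have "v i = v (i mod k)" "e i = e (i mod k)" for i
    using assms by (simp_all add: circle_param_def cong_def)
  then have "v i \<in> v ` {..<k}" "e i \<in> e ` {..<k}" for i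
    using \<open>k > 0\<close> by (metis imageI lessThan_iff mod_less_divisor)+
  then have "range v = v ` {..<k}" "range e = e ` {..<k}"
    by blast+
  then have img: "verts C = v ` {..<k}" "arcs C = e ` {..<k}"
    using assms by (simp_all add: circle_param_def)
  have inj: "inj_on v {..<k}" "inj_on e {..<k}"
    using assms by (auto simp: circle_param_def cong_def inj_on_def)
  show "finite (verts C)" "card (verts C) = k" "arcs C = e ` {..<k}" "inj_on e {..<k}" "finite (arcs C)"
    using img inj card_image[OF inj(1)] by simp_all
qed

lemma circle_param_in:
  assumes "circle_param C k v e"
  shows "v i \<in> verts C" "e i \<in> arcs C"
  using assms rangeI[of v i] rangeI[of e i] by (simp_all add: circle_param_def)

lemma circle_param_arc_eq:
  assumes "circle_param C k v e" "a \<in> arcs C"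
  shows "tail C a = v i \<Longrightarrow> a = e i" "head C a = v (Suc i) \<Longrightarrow> a = e i"
proof -
  have "a \<in> range e"
    using assms by (simp add: circle_param_def)
  then obtain j where j: "a = e j"
    by blast
  show "tail C a = v i \<Longrightarrow> a = e i" "head C a = v (Suc i) \<Longrightarrow> a = e i"
    using assms(1) cong_add_rcancel_nat[of j 1 i k] by (auto simp: circle_param_def j)
qed

text \<open>A component contains every arc of \<open>G\<close> at its vertices, and a circle has
  only one arc leaving each vertex, so a walk that starts on it never has a choice.\<close>

lemma circle_param_walk:
  assumes C: "circle_param C k v e" "C \<in> components G" "wf_digraph G"
    and walk: "\<And>i. e' i \<in> arcs G" "\<And>i. tail G (e' i) = v' i" "\<And>i. head G (e' i) = v' (Suc i)"
    and start: "v' 0 = v 0"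
  shows "v' i = v i \<and> e' i = e i"
proof -
  interpret wf_digraph G
    by (rule C(3))
  have arc: "e' i = e i" if "v' i = v i" for i
  proof (rule circle_param_arc_eq(1)[OF C(1)])
    have "v i \<in> verts C"
      using C(1) by (auto simp: circle_param_def)
    then show "e' i \<in> arcs C"
      using that walk by (intro components_arc_closed[OF C(2)]) auto
    show "tail C (e' i) = v i"
      using that walk components_tail_head[OF C(2)] by simp
  qed
  have "v' i = v i" for i
  proof (induction i)
    case (Suc i)
    then have "v' (Suc i) = head C (e i)"
      using arc walk(3)[of i] components_tail_head[OF C(2)] by simp
    then show ?case
      using C(1) by (simp add: circle_param_def)
  qed (rule start)
  then show ?thesis
    using arc by simp
qed

lemma wf_circle: "k \<ge> 1 \<Longrightarrow> wf_digraph (circle k)"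
  by unfold_locales (auto simp: circle_def)

lemma circle_param_to_circle:
  assumes "circle_param C k v e" "wf_digraph C" "g dvd k"
  obtains p where "is_graph_map C (circle g) p" "\<And>i. vmap p (v i) = i mod g" "\<And>i. amap p (e i) = i mod g"
    "g = k \<Longrightarrow> graph_iso C (circle g) p"
proof -
  have "k > 0"
    using assms(1) by (simp add: circle_param_def)
  then have "g > 0"
    using assms(3) by (auto intro: Nat.gr0I)
  \<comment> \<open>\<open>inv v\<close> and \<open>inv e\<close> choose some index; two indices of
    the same vertex or arc agree modulo \<open>k\<close>, hence modulo its divisor
    \<open>g\<close>.\<close>
  define p where "p = \<lparr>vmap = \<lambda>x. inv v x mod g, amap = \<lambda>x. inv e x mod g\<rparr>"
  have v: "vmap p (v i) = i mod g" for i
  proof -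
    have "v (inv v (v i)) = v i"
      by (simp add: f_inv_into_f)
    then have "[inv v (v i) = i] (mod k)"
      using assms(1) by (simp add: circle_param_def)
    then show ?thesis
      using assms(3) by (simp add: p_def cong_dvd_modulus_nat flip: cong_def)
  qed
  have e: "amap p (e i) = i mod g" for i
  proof -
    have "e (inv e (e i)) = e i"
      by (simp add: f_inv_into_f)
    then have "[inv e (e i) = i] (mod k)"
      using assms(1) by (simp add: circle_param_def)
    then show ?thesis
      using assms(3) by (simp add: p_def cong_dvd_modulus_nat flip: cong_def)
  qed
  have rng: "verts C = range v" "arcs C = range e" "\<And>i. tail C (e i) = v i" "\<And>i. head C (e i) = v (Suc i)"
    using assms(1) by (auto simp: circle_param_def)
  have map: "is_graph_map C (circle g) p"
    unfolding is_graph_map_def using assms(2) wf_circle[of g] \<open>g > 0\<close> rng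
    by (auto simp: v e circle_def mod_Suc_eq)
  have "graph_iso C (circle g) p" if "g = k"
    unfolding graph_iso_def
  proof (intro conjI map)
    have "i \<in> range (\<lambda>i. i mod k)" if "i < k" for i
      using that by (metis mod_less rangeI)
    then show "bij_betw (vmap p) (verts C) (verts (circle g))" "bij_betw (amap p) (arcs C) (arcs (circle g))"
      using assms(1) \<open>g > 0\<close> that
      by (auto simp: bij_betw_def rng inj_on_def v e circle_def image_image circle_param_def cong_def)
  qed
  then show thesis
    using map v e that by blast
qed

section \<open>Cores, periods and degrees\<close>

text \<open>By \<open>step\<close>, an equality of values can be shifted in both directions. So the
  sequence is purely periodic, and two equal values within one least period would give an earlier
  return to \<open>w 0\<close>.\<close>

lemma least_period:
  fixes w :: "nat \<Rightarrow> 'a"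
  assumes step: "\<And>i j. w (Suc i) = w (Suc j) \<longleftrightarrow> w i = w j" and "0 < p" "w p = w 0"
  shows "\<exists>k>0. \<forall>i j. w i = w j \<longleftrightarrow> [i = j] (mod k)"
proof -
  define k where "k = (LEAST k. 0 < k \<and> w k = w 0)"
  have k: "0 < k" "w k = w 0"
    using LeastI[of "\<lambda>k. 0 < k \<and> w k = w 0" p] assms by (auto simp: k_def)
  have least: "k \<le> m" if "0 < m" "w m = w 0" for m
    unfolding k_def using that by (intro Least_le) simp
  have shift: "w (i + n) = w (j + n) \<longleftrightarrow> w i = w j" for i j n
    by (induction n) (simp_all add: step)
  have add: "w (m + q * k) = w m" for m q
  proof (induction q)
    case (Suc q)
    then show ?case
      using shift[of k "m + q * k" 0] k(2) by (simp add: algebra_simps)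
  qed simp
  have mod: "w (n mod k) = w n" for n
    using add[of "n mod k" "n div k"] by simp
  have less: "i = j" if "w i = w j" "i \<le> j" "j < k" for i j
  proof (rule ccontr)
    assume "i \<noteq> j"
    then have "w (j - i) = w 0"
      using shift[of "j - i" i 0] that by simp
    then show False
      using least[of "j - i"] \<open>i \<noteq> j\<close> that by simp
  qed
  have "w i = w j \<longleftrightarrow> [i = j] (mod k)" for i j
    using less[of "i mod k" "j mod k"] less[of "j mod k" "i mod k"] k(1) mod[of i] mod[of j]
    by (metis cong_def mod_less_divisor nat_le_linear)
  then show ?thesis
    using k(1) by blast
qed

section \<open>The core and its components\<close>

lemma core_simps:
  "verts (core G) = (\<Union>(k, f)\<in>{(k, f). k \<ge> 1 \<and> is_graph_map (circle k) G f}. vmap f ` {..<k})"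
  "arcs (core G) = (\<Union>(k, f)\<in>{(k, f). k \<ge> 1 \<and> is_graph_map (circle k) G f}. amap f ` {..<k})"
  "tail (core G) = tail G" "head (core G) = head G"
proof -
  have "{graph_image f (circle k) G | k f. k \<ge> 1 \<and> is_graph_map (circle k) G f} =
    (\<lambda>(k, f). graph_image f (circle k) G) ` {(k, f). k \<ge> 1 \<and> is_graph_map (circle k) G f}"
    by auto
  then show "verts (core G) = (\<Union>(k, f)\<in>{(k, f). k \<ge> 1 \<and> is_graph_map (circle k) G f}. vmap f ` {..<k})"
    "arcs (core G) = (\<Union>(k, f)\<in>{(k, f). k \<ge> 1 \<and> is_graph_map (circle k) G f}. amap f ` {..<k})"
    "tail (core G) = tail G" "head (core G) = head G"
    by (simp_all add: core_def pre_digraph.Union_def graph_image_def case_prod_beta)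
qed

lemma core_arcs_subset: "arcs (core G) \<subseteq> arcs G"
  by (auto simp: core_simps is_graph_map_def)

lemma wf_core: "wf_digraph (core G)"
proof
  fix e assume "e \<in> arcs (core G)"
  then obtain k f i where f: "k \<ge> 1" "is_graph_map (circle k) G f" "i < k" "e = amap f i"
    by (auto simp: core_simps)
  then have "tail G e = vmap f i" "head G e = vmap f (Suc i mod k)" "Suc i mod k < k"
    by (auto simp: is_graph_map_def)
  moreover have "vmap f j \<in> verts (core G)" if "j < k" for j
    unfolding core_simps(1) using f(1,2) that by (intro UN_I[of "(k, f)"]) auto
  ultimately show "tail (core G) e \<in> verts (core G)" "head (core G) e \<in> verts (core G)"
    using f by (simp_all add: core_simps(3,4))
qed

text \<open>At most one arc leaves and at most one enters each vertex. So a cycle through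
  \<open>x\<close> runs around its least period, and each step of an undirected path in the core
  from \<open>x\<close> leads to the next or the previous vertex of that cycle.\<close>

lemma component_core_circle_param:
  assumes out: "\<And>a b. a \<in> arcs G \<Longrightarrow> b \<in> arcs G \<Longrightarrow> tail G a = tail G b \<Longrightarrow> a = b"
    and inc: "\<And>a b. a \<in> arcs G \<Longrightarrow> b \<in> arcs G \<Longrightarrow> head G a = head G b \<Longrightarrow> a = b"
    and C: "C \<in> components (core G)"
  shows "\<exists>k v e. circle_param C k v e"
proof -
  interpret core: wf_digraph "core G"
    by (rule wf_core)
  obtain x where x: "x \<in> verts (core G)" "C = component_of (core G) x"
    using C by (auto simp: core.components_iff)
  then obtain p f i0 where f: "p \<ge> 1" "is_graph_map (circle p) G f" "i0 < p" "x = vmap f i0"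
    by (auto simp: core_simps)
  define w where "w j = vmap f ((i0 + j) mod p)" for j
  define a where "a j = amap f ((i0 + j) mod p)" for j
  have w0: "w 0 = x"
    using f by (simp add: w_def)
  have a_core: "a j \<in> arcs (core G)" for j
  proof -
    have "a j \<in> amap f ` {..<p}"
      using f(1) by (auto simp: a_def)
    then show ?thesis
      using f(1,2) by (auto simp: core_simps)
  qed
  then have a_arc: "a j \<in> arcs G" for j
    by (rule subsetD[OF core_arcs_subset])
  have ends: "tail G (a j) = w j" "head G (a j) = w (Suc j)" for j
    using f(1,2) by (auto simp: a_def w_def is_graph_map_def mod_Suc_eq)
  have a_iff: "a i = a j \<longleftrightarrow> w i = w j" for i j
    using out[OF a_arc a_arc] ends by metis
  have step: "w (Suc i) = w (Suc j) \<longleftrightarrow> w i = w j" for i j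
    using inc[OF a_arc a_arc] ends a_iff by metis
  have w_add: "w (j + p) = w j" for j
    by (simp add: w_def flip: add.assoc)
  obtain k where k: "k > 0" "\<And>i j. w i = w j \<longleftrightarrow> [i = j] (mod k)"
    using least_period[of w p] step f(1) w_add[of 0] by auto
  have w_C: "w j \<in> verts C" for j
  proof (induction j)
    case 0
    then show ?case
      using x by (simp add: w0 core.component_of_simps)
  next
    case (Suc j)
    have "a j \<in> arcs C"
      using Suc ends[of j] a_core by (intro core.components_arc_closed[OF C]) (auto simp: core_simps)
    then have "head C (a j) \<in> verts C"
      using core.components_subgraph[OF C] by (auto intro: wf_digraph.head_in_verts)
    then show ?case
      using ends[of j] core.components_tail_head[OF C] by (simp add: core_simps)
  qed
  have C_w: "u \<in> range w" if "(x, u) \<in> (sym_arcs (core G))\<^sup>*" for u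
    using that
  proof (induction rule: rtrancl_induct)
    case base
    then show ?case
      using w0 by blast
  next
    case (step y z)
    then obtain j where j: "y = w j"
      by auto
    obtain b where b: "b \<in> arcs (core G)" "(y, z) = (tail G b, head G b) \<or> (y, z) = (head G b, tail G b)"
      using step(2) by (auto simp: sym_arcs_def core_simps)
    from b(1) have "b \<in> arcs G"
      by (rule subsetD[OF core_arcs_subset])
    \<comment> \<open>The index \<open>j + (p - 1)\<close> stands in for \<open>j - 1\<close>, which
      fails at \<open>j = 0\<close>; \<open>w\<close> repeats after \<open>p\<close> steps.\<close>
    have "w j = w (Suc (j + (p - 1)))"
      using w_add[of j] f(1) by simp
    with ends(2)[of "j + (p - 1)"] have last: "head G (a (j + (p - 1))) = w j"
      by (simp only:)
    from b(2) have "z = w (Suc j) \<or> z = w (j + (p - 1))"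
    proof
      assume "(y, z) = (tail G b, head G b)"
      then have "b = a j"
        using out[OF \<open>b \<in> arcs G\<close> a_arc[of j]] ends(1)[of j] j by (simp only: prod.inject)
      then show ?thesis
        using \<open>(y, z) = (tail G b, head G b)\<close> ends(2)[of j] by (simp only: prod.inject simp_thms)
    next
      assume "(y, z) = (head G b, tail G b)"
      then have "b = a (j + (p - 1))"
        using inc[OF \<open>b \<in> arcs G\<close> a_arc[of "j + (p - 1)"]] last j by (simp only: prod.inject)
      then show ?thesis
        using \<open>(y, z) = (head G b, tail G b)\<close> ends(1)[of "j + (p - 1)"] by (simp only: prod.inject simp_thms)
    qed
    then show ?case
      by auto
  qed
  have "verts C = range w"
    using C_w w_C by (auto simp: x(2) core.component_of_simps)
  moreover have "arcs C = range a"
  proof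
    show "range a \<subseteq> arcs C"
      using w_C a_core ends by (auto intro!: core.components_arc_closed[OF C] simp: core_simps)
    show "arcs C \<subseteq> range a"
    proof
      fix b assume b: "b \<in> arcs C"
      then have "tail C b \<in> verts C" "b \<in> arcs (core G)"
        using core.components_subgraph[OF C] by (auto intro: wf_digraph.tail_in_verts)
      from this(2) have "b \<in> arcs G"
        by (rule subsetD[OF core_arcs_subset])
      obtain j where "tail G b = w j"
        using \<open>tail C b \<in> verts C\<close> \<open>verts C = range w\<close> core.components_tail_head[OF C] by (auto simp: core_simps)
      then have "b = a j"
        using out[OF \<open>b \<in> arcs G\<close> a_arc[of j]] ends by simp
      then show "b \<in> range a"
        by blast
    qed
  qed
  ultimately have "circle_param C k w a"
    using k ends a_iff core.components_tail_head[OF C] by (simp add: circle_param_def core_simps)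
  then show ?thesis
    by blast
qed

section \<open>Periods of words\<close>

lemma gcd_period:
  fixes u :: "nat \<Rightarrow> 'a"
  assumes "0 < p" "\<And>i. u (i + p) = u i" "\<And>i. u (i + q) = u i"
  shows "u (i + gcd p q) = u i"
proof -
  have mult: "u (i + n * r) = u i" if "\<And>i. u (i + r) = u i" for i n r
  proof (induction n)
    case (Suc n)
    then show ?case
      using that[of "i + n * r"] by (simp add: algebra_simps)
  qed simp
  \<comment> \<open>Bezout's identity in the natural numbers: a shift by \<open>gcd p q\<close>
    followed by \<open>y\<close> shifts by \<open>q\<close> equals \<open>x\<close> shifts by
    \<open>p\<close>.\<close>
  obtain x y where "p * x = q * y + gcd p q"
    using bezout_nat[of p q] assms(1) by auto
  then have "i + gcd p q + y * q = i + x * p"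
    by (simp add: algebra_simps)
  then show ?thesis
    using mult[of q "i + gcd p q" y] mult[of p i x] assms by metis
qed

text \<open>A weak form of the theorem of Fine and Wilf, with \<open>p + q\<close> in place of
  \<open>p + q - gcd p q\<close>. The prefix suffices to compare \<open>u\<close> with its shift by
  \<open>q\<close> over a whole period \<open>p\<close>, so \<open>u\<close> has period
  \<open>q\<close> too; then both words are determined by their first \<open>q\<close>
  letters.\<close>

lemma common_prefix_periodic:
  fixes u u' :: "nat \<Rightarrow> 'a"
  assumes "0 < p" "0 < q" "\<And>i. u (i + p) = u i" "\<And>i. u' (i + q) = u' i"
    and prefix: "\<And>i. i < p + q \<Longrightarrow> u i = u' i"
  shows "u i = u' i"
proof -
  have period_mod: "v (i mod r) = v i" if "\<And>i. v (i + r) = v i" for v :: "nat \<Rightarrow> 'a" and i r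
  proof -
    have "v (m + n * r) = v m" for m n
    proof (induction n)
      case (Suc n)
      then show ?case
        using that[of "m + n * r"] by (simp add: algebra_simps)
    qed simp
    from this[of "i mod r" "i div r"] show ?thesis
      by simp
  qed
  have "u (i + q) = u i" for i
  proof -
    have "i mod p < p"
      using assms(1) by simp
    have "u (i + q) = u ((i mod p + q) mod p)"
      using period_mod[of u p "i + q"] assms(3) by (simp add: mod_simps)
    also have "\<dots> = u (i mod p + q)"
      using period_mod[of u p] assms(3) by blast
    also have "\<dots> = u' (i mod p)"
      using prefix[of "i mod p + q"] assms(4) \<open>i mod p < p\<close> by simp
    also have "\<dots> = u i"
      using prefix[of "i mod p"] \<open>i mod p < p\<close> period_mod[of u p i] assms(3) by simp
    finally show ?thesis .
  qed
  then have "u i = u (i mod q)"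
    using period_mod[of u q i] by simp
  also have "\<dots> = u' (i mod q)"
    using prefix[of "i mod q"] assms(2) by (simp add: trans_less_add2)
  also have "\<dots> = u' i"
    using period_mod[of u' q i] assms(4) by simp
  finally show ?thesis .
qed

text \<open>The word along the cycle also has the period \<open>g = gcd k q\<close>, so reducing
  indices modulo \<open>g\<close> factors \<open>f\<close> through \<open>circle g\<close>.
  Primitivity makes the reduction an isomorphism, hence \<open>k = g\<close>.\<close>

lemma primitive_cycle_period:
  assumes C: "circle_param C k v e" and map: "is_graph_map C G f" and prim: "primitive_cycle C G f"
    and period: "\<And>i. amap f (e (i + q)) = amap f (e i)"
  shows "k dvd q"
proof -
  have k: "k > 0" "verts C = range v" "arcs C = range e" "\<And>i. tail C (e i) = v i" "\<And>i. head C (e i) = v (Suc i)"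
    using C by (auto simp: circle_param_def)
  have arc: "amap f (e i) \<in> arcs G" "tail G (amap f (e i)) = vmap f (v i)"
    "head G (amap f (e i)) = vmap f (v (Suc i))" for i
    using map k by (auto simp: is_graph_map_def)
  define g where "g = gcd k q"
  have g: "g dvd k" "g \<ge> 1"
    using k(1) by (auto simp: g_def Suc_le_eq)
  have "e (i + k) = e i" for i
    using C by (simp add: circle_param_def cong_def)
  then have g_period: "amap f (e (i + g)) = amap f (e i)" for i
    unfolding g_def using gcd_period[of k "\<lambda>i. amap f (e i)" q i] k(1) period by simp
  have mult: "amap f (e (i + n * g)) = amap f (e i)" for i n
  proof (induction n)
    case (Suc n)
    then show ?case
      using g_period[of "i + n * g"] by (simp add: algebra_simps)
  qed simp
  have e_mod: "amap f (e (i mod g)) = amap f (e i)" for i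
    using mult[of "i mod g" "i div g"] by simp
  then have v_mod: "vmap f (v (i mod g)) = vmap f (v i)" for i
    using arc(2) by metis
  define h where "h = \<lparr>vmap = \<lambda>i. vmap f (v i), amap = \<lambda>i. amap f (e i)\<rparr>"
  have "wf_digraph C" "wf_digraph G"
    using map by (auto simp: is_graph_map_def)
  obtain p where p: "is_graph_map C (circle g) p" "\<And>i. vmap p (v i) = i mod g" "\<And>i. amap p (e i) = i mod g"
    using circle_param_to_circle[OF C \<open>wf_digraph C\<close> g(1)] by metis
  have "is_graph_map (circle g) G h"
    unfolding is_graph_map_def using wf_circle[OF g(2)] \<open>wf_digraph G\<close> arc map k
    by (auto simp: h_def v_mod is_graph_map_def)
  moreover have "factors_as C f h p"
    by (auto simp: factors_as_def k h_def p v_mod e_mod)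
  ultimately have "graph_iso C (circle g) p"
    using prim p(1) g(2) unfolding primitive_cycle_def by blast
  then have "bij_betw (vmap p) (verts C) (verts (circle g))"
    by (simp add: graph_iso_def)
  from bij_betw_same_card[OF this] have "k = g"
    using circle_param_card[OF C] by simp
  then show ?thesis
    by (metis g_def gcd_dvd2)
qed

section \<open>Degrees of cycles\<close>

lemma graph_iso_covering:
  assumes "graph_iso G H p"
  shows "covering_of_degree G H p 1"
proof -
  have iso: "inj_on (vmap p) (verts G)" "vmap p ` verts G = verts H"
    "inj_on (amap p) (arcs G)" "amap p ` arcs G = arcs H" "is_graph_map G H p"
    using assms by (auto simp: graph_iso_def bij_betw_def)
  have ends: "tail G e \<in> verts G" "head G e \<in> verts G" "tail H (amap p e) = vmap p (tail G e)"
    "head H (amap p e) = vmap p (head G e)" if "e \<in> arcs G" for e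
    using iso(5) that by (auto simp: is_graph_map_def intro: wf_digraph.tail_in_verts wf_digraph.head_in_verts)
  have out: "bij_betw (amap p) (out_arcs G v) (out_arcs H (vmap p v))" if "v \<in> verts G" for v
    unfolding bij_betw_def
  proof
    show "inj_on (amap p) (out_arcs G v)"
      by (rule inj_on_subset[OF iso(3)]) auto
    have "amap p ` out_arcs G v = {e \<in> amap p ` arcs G. tail H e = vmap p v}"
      using ends that inj_on_eq_iff[OF iso(1)] by (auto simp: image_iff out_arcs_def)
    then show "amap p ` out_arcs G v = out_arcs H (vmap p v)"
      by (simp add: iso(4) out_arcs_def)
  qed
  have inc: "bij_betw (amap p) (in_arcs G v) (in_arcs H (vmap p v))" if "v \<in> verts G" for v
    unfolding bij_betw_def
  proof
    show "inj_on (amap p) (in_arcs G v)"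
      by (rule inj_on_subset[OF iso(3)]) auto
    have "amap p ` in_arcs G v = {e \<in> amap p ` arcs G. head H e = vmap p v}"
      using ends that inj_on_eq_iff[OF iso(1)] by (auto simp: image_iff in_arcs_def)
    then show "amap p ` in_arcs G v = in_arcs H (vmap p v)"
      by (simp add: iso(4) in_arcs_def)
  qed
  have "card {v \<in> verts G. vmap p v = w} = 1" if w: "w \<in> verts H" for w
  proof -
    have "w \<in> vmap p ` verts G"
      using w iso(2) by simp
    then obtain v where "v \<in> verts G" "vmap p v = w"
      by blast
    then have "{v \<in> verts G. vmap p v = w} = {v}"
      using iso(1) by (auto dest: inj_onD)
    then show ?thesis
      by simp
  qed
  then show ?thesis
    using iso out inc by (auto simp: covering_of_degree_def covering_map_def)
qed

text \<open>If \<open>f\<close> factors through \<open>circle k\<close> by a covering of degree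
  \<open>m\<close>, counting fibres gives \<open>K = k * m\<close>. The other factor walks along
  \<open>D\<close> and closes up after \<open>k\<close> steps, so \<open>L\<close> divides
  \<open>k\<close>.\<close>

lemma cycle_degree_le:
  assumes C: "circle_param C K V E" and map: "is_graph_map C G f" and D: "circle_param D L v e" "D \<in> components G"
    and start: "vmap f (V 0) = v 0" and "n \<le> cycle_degree C G f"
  shows "n * L \<le> K"
proof -
  define M where "M = {m. \<exists>k \<ge> 1. \<exists>p g. covering_of_degree C (circle k) p m \<and>
    is_graph_map (circle k) G g \<and> factors_as C f g p}"
  have wf: "wf_digraph C" "wf_digraph G"
    using map by (auto simp: is_graph_map_def)
  have K: "K > 0" "verts C = range V" "arcs C = range E" "\<And>i. tail C (E i) = V i" "\<And>i. head C (E i) = V (Suc i)"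
    using C by (auto simp: circle_param_def)
  have mult: "m * L \<le> K \<and> m \<le> K" if "m \<in> M" for m
  proof -
    obtain k p g where k: "k \<ge> 1" "covering_of_degree C (circle k) p m"
      and g: "is_graph_map (circle k) G g" "factors_as C f g p"
      using \<open>m \<in> M\<close> by (auto simp: M_def)
    have p: "vmap p x < k" if "x \<in> verts C" for x
      using k(2) that by (auto simp: covering_of_degree_def covering_map_def is_graph_map_def)
    have "(\<Union>w\<in>{..<k}. {x \<in> verts C. vmap p x = w}) = verts C"
      using p by auto
    then have "K = card (\<Union>w\<in>{..<k}. {x \<in> verts C. vmap p x = w})"
      using circle_param_card(2)[OF C] by simp
    also have "\<dots> = (\<Sum>w\<in>{..<k}. card {x \<in> verts C. vmap p x = w})"
      using circle_param_card(1)[OF C] by (intro card_UN_disjoint) auto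
    also have "\<dots> = k * m"
      using k(2) by (simp add: covering_of_degree_def)
    finally have "K = k * m" .
    define i0 where "i0 = vmap p (V 0)"
    have "i0 < k"
      using p K(2) by (auto simp: i0_def)
    have "vmap g ((i0 + i) mod k) = v i \<and> amap g ((i0 + i) mod k) = e i" for i
    proof (rule circle_param_walk[OF D wf(2)])
      show "amap g ((i0 + i) mod k) \<in> arcs G" "tail G (amap g ((i0 + i) mod k)) = vmap g ((i0 + i) mod k)"
        "head G (amap g ((i0 + i) mod k)) = vmap g ((i0 + Suc i) mod k)" for i
        using g(1) k(1) by (auto simp: is_graph_map_def mod_Suc_eq)
      show "vmap g ((i0 + 0) mod k) = v 0"
        using g(2) K(2) start \<open>i0 < k\<close> by (simp add: factors_as_def i0_def)
    qed
    from this[of k] this[of 0] have "v k = v 0"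
      by simp
    then have "L dvd k"
      using D(1) by (simp add: circle_param_def cong_0_iff)
    then have "L \<le> k"
      using k(1) by (intro dvd_imp_le) auto
    then show ?thesis
      using \<open>K = k * m\<close> k(1) by simp
  qed
  \<comment> \<open>Degree 1 comes from identifying \<open>C\<close> with \<open>circle K\<close>.
    So \<open>M\<close> is nonempty and, being finite, contains its maximum.\<close>
  have "1 \<in> M"
  proof -
    obtain p where p: "graph_iso C (circle K) p" "\<And>i. vmap p (V i) = i mod K" "\<And>i. amap p (E i) = i mod K"
      using circle_param_to_circle[OF C wf(1) dvd_refl] by metis
    define g where "g = \<lparr>vmap = \<lambda>i. vmap f (V i), amap = \<lambda>i. amap f (E i)\<rparr>"
    have mod: "V (i mod K) = V i" "E (i mod K) = E i" for i
      using C by (simp_all add: circle_param_def cong_def)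
    have "is_graph_map (circle K) G g"
      unfolding is_graph_map_def using wf_circle[of K] wf(2) map K
      by (auto simp: g_def mod is_graph_map_def)
    moreover have "factors_as C f g p"
      by (auto simp: factors_as_def K g_def p mod)
    ultimately show ?thesis
      unfolding M_def using graph_iso_covering[OF p(1)] K(1) by (auto intro!: exI[of _ K])
  qed
  moreover have "finite M"
    using mult by (intro finite_subset[of M "{..K}"]) auto
  ultimately have "Max M \<in> M"
    by (intro Max_in) auto
  moreover have "cycle_degree C G f = Max M"
    by (simp add: cycle_degree_def M_def)
  ultimately have "cycle_degree C G f * L \<le> K"
    using mult by simp
  then show ?thesis
    using \<open>n \<le> cycle_degree C G f\<close> by (meson le_trans mult_le_mono1)
qed

section \<open>The fibre product\<close>

locale immersed_circles =
  fixes \<Gamma> :: "('a, 'b) pre_digraph"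
    and \<Delta> :: "('c, 'd) pre_digraph"
    and S :: "('e, 'f) pre_digraph"
    and \<gamma> :: "('a, 'b, 'c, 'd) graph_map"
    and l :: "('e, 'f, 'c, 'd) graph_map"
  assumes imm_\<gamma>: "immersion \<Gamma> \<Delta> \<gamma>"
    and imm_l: "immersion S \<Delta> l"
    and circles: "\<forall>C \<in> components S. is_circle C"
    and primitive: "\<forall>C \<in> components S. primitive_cycle C \<Delta> l"
    and inequivalent: "\<forall>C \<in> components S. \<forall>C' \<in> components S. C \<noteq> C' \<longrightarrow> \<not> equivalent_cycles C l C' l"
begin

section \<open>Label words of the immersed circles\<close>

lemma wf_\<Gamma>: "wf_digraph \<Gamma>" and wf_S: "wf_digraph S"
  using imm_\<gamma> imm_l by (auto simp: immersion_def is_graph_map_def)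

lemma l_tail: "e \<in> arcs S \<Longrightarrow> tail \<Delta> (amap l e) = vmap l (tail S e)"
  using imm_l by (auto simp: immersion_def is_graph_map_def)

lemma \<gamma>_tail_inj:
  assumes "a \<in> arcs \<Gamma>" "b \<in> arcs \<Gamma>" "tail \<Gamma> a = tail \<Gamma> b" "amap \<gamma> a = amap \<gamma> b"
  shows "a = b"
proof -
  have "inj_on (amap \<gamma>) (out_arcs \<Gamma> (tail \<Gamma> b))"
    using imm_\<gamma> wf_digraph.tail_in_verts[OF wf_\<Gamma> assms(2)] by (simp add: immersion_def)
  then show ?thesis
    using assms by (auto dest: inj_onD)
qed

lemma \<gamma>_head_inj:
  assumes "a \<in> arcs \<Gamma>" "b \<in> arcs \<Gamma>" "head \<Gamma> a = head \<Gamma> b" "amap \<gamma> a = amap \<gamma> b"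
  shows "a = b"
proof -
  have "inj_on (amap \<gamma>) (in_arcs \<Gamma> (head \<Gamma> b))"
    using imm_\<gamma> wf_digraph.head_in_verts[OF wf_\<Gamma> assms(2)] by (simp add: immersion_def)
  then show ?thesis
    using assms by (auto dest: inj_onD)
qed

lemma S_component:
  assumes "x \<in> verts S"
  shows "component_of S x \<in> components S"
  using wf_digraph.components_iff[OF wf_S] assms by blast

lemma S_arc_component:
  assumes "a \<in> arcs S"
  shows "component_of S (tail S a) \<in> components S" "a \<in> arcs (component_of S (tail S a))"
proof -
  show "component_of S (tail S a) \<in> components S"
    by (intro S_component wf_digraph.tail_in_verts[OF wf_S assms])
  then show "a \<in> arcs (component_of S (tail S a))"
    using wf_digraph.arcs_component_of(1)[OF wf_S assms] by simp
qed

lemma S_param: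
  assumes "a \<in> arcs S"
  obtains k v e where "circle_param (component_of S (tail S a)) k v e" "e 0 = a" "v 0 = tail S a"
proof -
  let ?C = "component_of S (tail S a)"
  obtain k v e where param: "circle_param ?C k v e"
    using circles S_arc_component(1)[OF assms] is_circle_param by blast
  have "a \<in> range e"
    using param S_arc_component(2)[OF assms] by (simp add: circle_param_def)
  then obtain n where n: "a = e n"
    by blast
  have "v n = tail S a"
    using param n wf_digraph.components_tail_head(1)[OF wf_S S_arc_component(1)[OF assms]]
    by (simp add: circle_param_def)
  then show thesis
    using that[OF circle_param_shift[OF param, of n]] n by simp
qed

lemma S_tail_inj:
  assumes "a \<in> arcs S" "b \<in> arcs S" "tail S a = tail S b"
  shows "a = b"
proof -
  obtain k v e where param: "circle_param (component_of S (tail S a)) k v e" "e 0 = a" "v 0 = tail S a"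
    using S_param[OF assms(1)] by metis
  have "b = e 0"
    using circle_param_arc_eq(1)[OF param(1), of b 0] S_arc_component[OF assms(2)] param(3) assms(3)
      wf_digraph.components_tail_head(1)[OF wf_S S_arc_component(1)[OF assms(2)]] by simp
  then show ?thesis
    using param by simp
qed

lemma S_head_inj:
  assumes "a \<in> arcs S" "b \<in> arcs S" "head S a = head S b"
  shows "a = b"
proof -
  let ?C = "component_of S (tail S a)"
  have C: "?C \<in> components S" "a \<in> arcs ?C"
    using S_arc_component[OF assms(1)] by auto
  obtain k v e where param: "circle_param ?C k v e" "e 0 = a" "v 0 = tail S a"
    using S_param[OF assms(1)] by metis
  have ht: "head ?C = head S"
    by (rule wf_digraph.components_tail_head(2)[OF wf_S C(1)])
  have head_a: "head S a = v (Suc 0)"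
    using param ht by (auto simp: circle_param_def)
  moreover have "v (Suc 0) \<in> verts ?C"
    using param(1) by (auto simp: circle_param_def)
  ultimately have "b \<in> arcs ?C"
    using assms by (intro wf_digraph.components_arc_closed[OF wf_S C(1)]) auto
  then have "b = e 0"
    using circle_param_arc_eq(2)[OF param(1), of b 0] head_a ht assms(3) by simp
  then show ?thesis
    using param by simp
qed

text \<open>By \<open>common_prefix_periodic\<close> the label words agree everywhere, so each
  length is a period of the other word, and primitivity gives \<open>k1 = k2\<close>. It remains to
  identify the circles and then the starting points.\<close>

lemma S_separated:
  assumes C1: "C1 \<in> components S" "circle_param C1 k1 v1 e1"
    and C2: "C2 \<in> components S" "circle_param C2 k2 v2 e2"
    and prefix: "\<And>i. i < k1 + k2 \<Longrightarrow> amap l (e1 i) = amap l (e2 i)"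
  shows "e1 0 = e2 0"
proof -
  have param: "0 < k1" "0 < k2" "verts C1 = range v1" "verts C2 = range v2"
    "arcs C1 = range e1" "arcs C2 = range e2"
    "\<And>i. e1 (i + k1) = e1 i" "\<And>i. e2 (i + k2) = e2 i"
    "\<And>i. tail S (e1 i) = v1 i" "\<And>i. tail S (e2 i) = v2 i"
    "\<And>i. head S (e1 i) = v1 (Suc i)" "\<And>i. head S (e2 i) = v2 (Suc i)"
    using C1(2) C2(2) wf_digraph.components_tail_head[OF wf_S C1(1)] wf_digraph.components_tail_head[OF wf_S C2(1)]
    by (auto simp: circle_param_def cong_def)
  have sub: "subgraph C1 S" "subgraph C2 S"
    using C1(1) C2(1) wf_digraph.components_subgraph[OF wf_S] by auto
  have map: "is_graph_map C \<Delta> l" if "subgraph C S" for C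
    using that imm_l by (auto simp: is_graph_map_def immersion_def subgraph_def compatible_def)
  have arcs: "e1 i \<in> arcs S" "e2 i \<in> arcs S" for i
    using sub param(5,6) by (auto simp: subgraph_def)
  have eq: "amap l (e1 i) = amap l (e2 i)" for i
    using common_prefix_periodic[of k1 k2 "\<lambda>i. amap l (e1 i)" "\<lambda>i. amap l (e2 i)" i] param prefix by simp
  have "amap l (e1 (i + k2)) = amap l (e1 i)" for i
    using eq param(8) by simp
  then have "k1 dvd k2"
    using C1 primitive by (intro primitive_cycle_period[OF C1(2) map[OF sub(1)]]) auto
  have "amap l (e2 (i + k1)) = amap l (e2 i)" for i
    using eq[of "i + k1"] eq[of i] param(7) by simp
  then have "k2 dvd k1"
    using C2 primitive by (intro primitive_cycle_period[OF C2(2) map[OF sub(2)]]) auto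
  with \<open>k1 dvd k2\<close> have "k1 = k2"
    by (rule dvd_antisym)
  have veq: "vmap l (v1 i) = vmap l (v2 i)" for i
    using eq[of i] l_tail[OF arcs(1), of i] l_tail[OF arcs(2), of i] param by simp
  have "C1 = C2"
  proof (rule ccontr)
    assume "C1 \<noteq> C2"
    \<comment> \<open>Matching the two parametrisations index by index gives an isomorphism over
      \<open>\<Delta>\<close>, which \<open>inequivalent\<close> forbids.\<close>
    define p where "p = \<lparr>vmap = \<lambda>x. v2 (inv v1 x), amap = \<lambda>x. e2 (inv e1 x)\<rparr>"
    have v: "vmap p (v1 i) = v2 i" for i
    proof -
      have "v1 (inv v1 (v1 i)) = v1 i"
        by (simp add: f_inv_into_f)
      then show ?thesis
        using C1(2) C2(2) \<open>k1 = k2\<close> by (simp add: p_def circle_param_def)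
    qed
    have e: "amap p (e1 i) = e2 i" for i
    proof -
      have "e1 (inv e1 (e1 i)) = e1 i"
        by (simp add: f_inv_into_f)
      then show ?thesis
        using C1(2) C2(2) \<open>k1 = k2\<close> by (simp add: p_def circle_param_def)
    qed
    have "is_graph_map C1 C2 p"
      unfolding is_graph_map_def using sub param C1(2) C2(2) by (auto simp: v e circle_param_def)
    moreover have "bij_betw (vmap p) (verts C1) (verts C2)" "bij_betw (amap p) (arcs C1) (arcs C2)"
      using C1(2) C2(2) \<open>k1 = k2\<close>
      by (auto simp: bij_betw_def param inj_on_def v e image_image circle_param_def)
    ultimately have "graph_iso C1 C2 p"
      by (simp add: graph_iso_def)
    moreover have "factors_as C1 l l p"
      by (auto simp: factors_as_def param v e eq veq)
    ultimately show False
      using inequivalent C1(1) C2(1) \<open>C1 \<noteq> C2\<close> by (auto simp: equivalent_cycles_def)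
  qed
  have "e2 0 \<in> range e1"
    using param(5,6) \<open>C1 = C2\<close> by auto
  then obtain n where n: "e2 0 = e1 n"
    by blast
  \<comment> \<open>On the same circle the parametrisations differ by a shift by \<open>n\<close>.
    This shift preserves the labels, so by primitivity \<open>n\<close> is a multiple of
    \<open>k1\<close>.\<close>
  have start: "v2 0 = v1 (0 + n)"
    using param(9,10) n by (metis add_0)
  have walk: "v2 i = v1 (i + n) \<and> e2 i = e1 (i + n)" for i
    by (rule circle_param_walk[OF circle_param_shift[OF C1(2)] C1(1) wf_S arcs(2) param(10) param(12) start])
  have "amap l (e1 (i + n)) = amap l (e1 i)" for i
    using eq[of i] walk[of i] by simp
  then have "k1 dvd n"
    using C1 primitive by (intro primitive_cycle_period[OF C1(2) map[OF sub(1)]]) auto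
  then show ?thesis
    using n C1(2) by (simp add: circle_param_def cong_def dvd_eq_mod_eq_0)
qed

section \<open>The fibre product and its core circles\<close>

definition F :: "('a \<times> 'e, 'b \<times> 'f) pre_digraph" where
  "F = fibre_product \<Gamma> \<gamma> S l"

lemma F_arcs: "z \<in> arcs F \<longleftrightarrow> fst z \<in> arcs \<Gamma> \<and> snd z \<in> arcs S \<and> amap \<gamma> (fst z) = amap l (snd z)"
  and F_ends: "tail F z = (tail \<Gamma> (fst z), tail S (snd z))" "head F z = (head \<Gamma> (fst z), head S (snd z))"
  by (auto simp: F_def fibre_product_def case_prod_beta)

text \<open>The coordinate in \<open>S\<close> is determined because the components of
  \<open>S\<close> are circles; it fixes the label in \<open>\<Delta>\<close>, and as
  \<open>\<gamma>\<close> is an immersion this fixes the coordinate in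
  \<open>\<Gamma>\<close>.\<close>

lemma F_tail_inj: "a \<in> arcs F \<Longrightarrow> b \<in> arcs F \<Longrightarrow> tail F a = tail F b \<Longrightarrow> a = b"
  using S_tail_inj[of "snd a" "snd b"] \<gamma>_tail_inj[of "fst a" "fst b"] by (simp add: F_arcs F_ends prod_eq_iff)

lemma F_head_inj: "a \<in> arcs F \<Longrightarrow> b \<in> arcs F \<Longrightarrow> head F a = head F b \<Longrightarrow> a = b"
  using S_head_inj[of "snd a" "snd b"] \<gamma>_head_inj[of "fst a" "fst b"] by (simp add: F_arcs F_ends prod_eq_iff)

lemma core_component_param: "C \<in> components (core F) \<Longrightarrow> \<exists>k v e. circle_param C k v e"
  by (rule component_core_circle_param[OF F_tail_inj F_head_inj])

lemma core_component:
  assumes "C \<in> components (core F)"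
  shows "arcs C \<subseteq> arcs F" "tail C = tail F" "head C = head F" "is_graph_map C S proj_snd"
proof -
  have sub: "subgraph C (core F)"
    using assms by (rule wf_digraph.components_subgraph[OF wf_core])
  then show arcs: "arcs C \<subseteq> arcs F" and ends: "tail C = tail F" "head C = head F"
    using core_arcs_subset[of F] by (auto simp: subgraph_def compatible_def core_simps)
  obtain k v e where param: "circle_param C k v e"
    using core_component_param[OF assms] by auto
  have "snd x \<in> verts S" if "x \<in> verts C" for x
  proof -
    have "x \<in> range v"
      using param that by (simp add: circle_param_def)
    then obtain i where "x = v i"
      by blast
    then have "x = tail F (e i)" "e i \<in> arcs F"
      using param arcs ends circle_param_in(2)[OF param, of i] by (auto simp: circle_param_def)
    then show ?thesis
      by (simp add: F_arcs F_ends wf_digraph.tail_in_verts[OF wf_S])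
  qed
  moreover have "wf_digraph C"
    using sub by auto
  ultimately show "is_graph_map C S proj_snd"
    using arcs ends wf_S by (auto simp: is_graph_map_def proj_snd_def F_arcs F_ends)
qed

lemma core_component_arc:
  assumes "C \<in> components (core F)" "circle_param C k v e"
  shows "e i \<in> arcs F" "tail F (e i) = v i" "head F (e i) = v (Suc i)"
  using core_component[OF assms(1)] circle_param_in(2)[OF assms(2), of i] assms(2)
  by (auto simp: circle_param_def)

definition period :: "'f \<Rightarrow> nat" where
  "period a = card (verts (component_of S (tail S a)))"

text \<open>Such an arc is unique by \<open>F_tail_inj\<close>, and on a core circle it exists,
  being the next arc. Elsewhere the description may be unspecified.\<close>

definition succ :: "'b \<times> 'f \<Rightarrow> 'b \<times> 'f" where
  "succ z = (THE z'. z' \<in> arcs F \<and> tail F z' = head F z)"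

lemma core_component_succ:
  assumes C: "C \<in> components (core F)" "circle_param C k v e"
  shows "(succ ^^ n) (e i) = e (i + n)"
proof -
  note e = core_component_arc[OF C]
  have "succ (e j) = e (Suc j)" for j
    unfolding succ_def using e F_tail_inj by (intro the_equality) auto
  then show ?thesis
    by (induction n) auto
qed

lemma core_component_walk:
  assumes C: "C \<in> components (core F)" "circle_param C k v e"
    and D: "D = component_of S (tail S (snd (e i)))" "circle_param D L w d" "d 0 = snd (e i)"
  shows "snd (v (i + n)) = w n \<and> snd (e (i + n)) = d n"
proof -
  note e = core_component_arc[OF C]
  have arc: "snd (e j) \<in> arcs S" "tail S (snd (e j)) = snd (v j)" "head S (snd (e j)) = snd (v (Suc j))" for j
    using e[of j] by (auto simp: F_arcs F_ends prod_eq_iff)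
  have "D \<in> components S"
    using S_arc_component(1)[OF arc(1)] D(1) by simp
  moreover have "tail D (d 0) = w 0"
    using D(2) by (simp add: circle_param_def)
  then have "snd (v (i + 0)) = w 0"
    using D(3) arc(2)[of i] wf_digraph.components_tail_head(1)[OF wf_S \<open>D \<in> components S\<close>] by simp
  ultimately show ?thesis
    using arc circle_param_walk[OF D(2) _ wf_S, of "\<lambda>j. snd (e (i + j))" "\<lambda>j. snd (v (i + j))" n] by simp
qed

text \<open>Parametrises the core circle from \<open>z\<close> and the circle of \<open>S\<close>
  below from \<open>snd z\<close>, so that index \<open>n\<close> on both corresponds to
  \<open>n\<close> applications of \<open>succ\<close>.\<close>

lemma core_arc_cases:
  assumes "C \<in> components (core F)" "z \<in> arcs C"
  obtains k v e D L w d where "circle_param C k v e" "e 0 = z" "D \<in> components S" "circle_param D L w d"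
    "d 0 = snd z" "snd (v 0) = w 0" "L = period (snd z)"
    "\<And>n. (succ ^^ n) z = e n" "\<And>n. snd (e n) = d n" "\<And>n. period (d n) = L"
proof -
  obtain k v' e' where param': "circle_param C k v' e'"
    using core_component_param[OF assms(1)] by auto
  then have "z \<in> range e'"
    using assms(2) by (simp add: circle_param_def)
  then obtain n where "z = e' n"
    by blast
  define v e where "v i = v' (i + n)" and "e i = e' (i + n)" for i
  have param: "circle_param C k v e"
    using circle_param_shift[OF param', of n] by (simp add: v_def[abs_def] e_def[abs_def])
  have e0: "e 0 = z"
    by (simp add: e_def \<open>z = e' n\<close>)
  have "snd z \<in> arcs S"
    using subsetD[OF core_component(1)[OF assms(1)] assms(2)] by (simp add: F_arcs)
  define D where "D = component_of S (tail S (snd z))"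
  have D: "D \<in> components S"
    using S_arc_component(1)[OF \<open>snd z \<in> arcs S\<close>] by (simp add: D_def)
  obtain L w d where d: "circle_param D L w d" "d 0 = snd z" "w 0 = tail S (snd z)"
    using S_param[OF \<open>snd z \<in> arcs S\<close>] by (metis D_def)
  have walk: "snd (v n) = w n \<and> snd (e n) = d n" for n
    using core_component_walk[OF assms(1) param, of D 0 L w d n] d e0 by (simp add: D_def)
  have period: "period (d n) = L" for n
  proof -
    have "tail S (d n) = w n"
      using d(1) wf_digraph.components_tail_head(1)[OF wf_S D] by (simp add: circle_param_def)
    moreover have "component_of S (w n) = D"
      by (rule wf_digraph.component_of_eq[OF wf_S D circle_param_in(1)[OF d(1)]])
    ultimately show ?thesis
      using circle_param_card(2)[OF d(1)] by (simp add: period_def)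
  qed
  have "(succ ^^ n) z = e n" for n
    using core_component_succ[OF assms(1) param, of n 0] by (simp add: e0)
  then show thesis
    using that[OF param e0 D d(1,2)] walk period period[of 0] d(2) by simp
qed

lemma succ_arc:
  assumes "C \<in> components (core F)" "z \<in> arcs C"
  shows "succ z \<in> arcs C" "tail F (succ z) = head F z"
proof -
  obtain k v e where param: "circle_param C k v e" "e 0 = z" "\<And>n. (succ ^^ n) z = e n"
    using core_arc_cases[OF assms] by metis
  have "succ z = e (Suc 0)"
    using param(3)[of "Suc 0"] by simp
  then show "succ z \<in> arcs C" "tail F (succ z) = head F z"
    using circle_param_in(2)[OF param(1)] core_component_arc[OF assms(1) param(1)] param(2) by auto
qed

text \<open>The image in \<open>\<Gamma>\<close> of the fundamental class of the circle: the
  coefficient at an arc counts how often \<open>C\<close> passes over it, always in the positive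
  direction.\<close>

definition chain :: "('a \<times> 'e, 'b \<times> 'f) pre_digraph \<Rightarrow> ('b \<Rightarrow>\<^sub>0 real)" where
  "chain C = (\<Sum>z\<in>arcs C. Poly_Mapping.single (fst z) 1)"

lemma lookup_chain:
  assumes "finite (arcs C)"
  shows "Poly_Mapping.lookup (chain C) e = real (card {z \<in> arcs C. fst z = e})"
proof -
  have "Poly_Mapping.lookup (chain C) e = (\<Sum>z\<in>arcs C. if fst z = e then 1 else 0)"
    by (simp add: chain_def lookup_sum lookup_single when_def)
  also have "\<dots> = (\<Sum>z\<in>{z \<in> arcs C. fst z = e}. 1)"
    using assms by (intro sum.mono_neutral_cong_right) auto
  finally show ?thesis
    by simp
qed

lemma core_component_finite:
  assumes "C \<in> components (core F)"
  shows "finite (arcs C)"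
  using core_component_param[OF assms] circle_param_card(5) by blast

lemma chain_cycle_space:
  assumes "C \<in> components (core F)"
  shows "chain C \<in> cycle_space \<Gamma>"
proof -
  obtain k v e where param: "circle_param C k v e"
    using core_component_param[OF assms] by auto
  have arcs: "arcs C = e ` {..<k}" "inj_on e {..<k}"
    using circle_param_card[OF param] by auto
  have ends: "tail \<Gamma> (fst (e i)) = fst (v i)" "head \<Gamma> (fst (e i)) = fst (v (Suc i))" for i
    using core_component_arc[OF assms param, of i] by (auto simp: F_ends prod_eq_iff)
  have "v k = v 0"
    using param by (simp add: circle_param_def cong_def)
  have "boundary \<Gamma> (chain C) = (\<Sum>i<k. Poly_Mapping.single (fst (v (Suc i))) 1 - Poly_Mapping.single (fst (v i)) 1)"
    unfolding chain_def arcs(1) sum.reindex[OF arcs(2)]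
    by (simp add: boundary_sum boundary_single ends)
  also have "\<dots> = 0"
    using \<open>v k = v 0\<close> sum_lessThan_telescope[of "\<lambda>i. Poly_Mapping.single (fst (v i)) (1::real)" k] by simp
  finally have "boundary \<Gamma> (chain C) = 0" .
  moreover have "Poly_Mapping.keys (chain C) \<subseteq> arcs \<Gamma>"
  proof
    fix a assume "a \<in> Poly_Mapping.keys (chain C)"
    then have "{z \<in> arcs C. fst z = a} \<noteq> {}"
      using lookup_chain[OF core_component_finite[OF assms], of a] by (metis card.empty in_keys_iff of_nat_0)
    then show "a \<in> arcs \<Gamma>"
      using core_component(1)[OF assms] F_arcs by auto
  qed
  ultimately show ?thesis
    by (simp add: cycle_space_def)
qed

text \<open>The coefficients of \<open>chain C\<close> are counts, so passages cannot cancel and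
  this cycle is not zero.\<close>

lemma betti1_pos:
  assumes "C \<in> components (core F)"
  shows "1 \<le> betti1 \<Gamma>"
proof -
  obtain k v e where param: "circle_param C k v e"
    using core_component_param[OF assms] by auto
  have "{z \<in> arcs C. fst z = fst (e 0)} \<noteq> {}"
    using circle_param_in(2)[OF param] by blast
  then have "Poly_Mapping.lookup (chain C) (fst (e 0)) \<noteq> 0"
    using core_component_finite[OF assms] by (simp add: lookup_chain)
  then have "enat (card {C}) \<le> betti1 \<Gamma>"
    using chain_cycle_space[OF assms] by (intro betti1_ge_card_chains[of _ chain]) auto
  then show ?thesis
    by (simp add: one_enat_def)
qed

text \<open>The points are the arcs of the circles in \<open>Y\<close>, lying over
  \<open>\<Gamma>\<close> by \<open>fst\<close> and labelled by arcs of \<open>\<Delta>\<close>. An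
  arc of \<open>\<Gamma>\<close> with a single point over it is private to the circle through that
  point.\<close>

lemma ex_private_arc:
  assumes Y: "finite Y" "Y \<noteq> {}" "Y \<subseteq> components (core F)"
    and b: "betti1 \<Gamma> = enat b"
    and degree: "\<And>C. C \<in> Y \<Longrightarrow> 12 * b \<le> cycle_degree C S proj_snd"
  shows "\<exists>C\<in>Y. \<exists>e. Poly_Mapping.lookup (chain C) e \<noteq> 0 \<and>
    (\<forall>C'\<in>Y - {C}. Poly_Mapping.lookup (chain C') e = 0)"
proof -
  define P where "P = (\<Union>C\<in>Y. arcs C)"
  have PE: "\<exists>C\<in>Y. C \<in> components (core F) \<and> z \<in> arcs C" if "z \<in> P" for z
    using that Y(3) by (auto simp: P_def)
  have fin: "finite P"
    using Y core_component_finite by (auto simp: P_def)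
  have PF: "z \<in> arcs F" if "z \<in> P" for z
    using PE[OF that] core_component(1) by blast
  have succ_P: "succ z \<in> P" "tail F (succ z) = head F z" if "z \<in> P" for z
  proof -
    obtain C where "C \<in> Y" "C \<in> components (core F)" "z \<in> arcs C"
      using PE[OF \<open>z \<in> P\<close>] by blast
    then show "succ z \<in> P" "tail F (succ z) = head F z"
      using succ_arc[of C z] by (auto simp: P_def)
  qed
  \<comment> \<open>Labels must be natural numbers to serve as digits; an injective encoding of the
    finitely many arcs of \<open>\<Delta>\<close> that occur is enough.\<close>
  have "\<exists>enc :: 'd \<Rightarrow> nat. inj_on enc (amap \<gamma> ` fst ` P)"
    using finite_imp_inj_to_nat_seg[of "amap \<gamma> ` fst ` P"] fin by blast
  then obtain enc :: "'d \<Rightarrow> nat" where enc: "inj_on enc (amap \<gamma> ` fst ` P)"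
    by blast
  have encD: "amap \<gamma> (fst x) = amap \<gamma> (fst y)"
    if "x \<in> P" "y \<in> P" "enc (amap \<gamma> (fst x)) = enc (amap \<gamma> (fst y))" for x y
    using inj_onD[OF enc that(3)] that by blast
  interpret labelled_circles P succ fst "tail \<Gamma>" "head \<Gamma>" "\<lambda>e. enc (amap \<gamma> e)" "\<lambda>z. period (snd z)"
  proof
    show "finite P"
      by (rule fin)
    show "inj_on succ P"
    proof (rule inj_onI)
      fix x y assume "x \<in> P" "y \<in> P" "succ x = succ y"
      then have "head F x = head F y"
        using succ_P(2)[of x] succ_P(2)[of y] by simp
      then show "x = y"
        using PF \<open>x \<in> P\<close> \<open>y \<in> P\<close> by (intro F_head_inj) auto
    qed
    show "fst x = fst y"
      if "x \<in> P" "y \<in> P" "tail \<Gamma> (fst x) = tail \<Gamma> (fst y)" "enc (amap \<gamma> (fst x)) = enc (amap \<gamma> (fst y))" for x y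
      using that PF[OF that(1)] PF[OF that(2)] encD[OF that(1,2,4)] by (intro \<gamma>_tail_inj) (auto simp: F_arcs)
    fix x assume x: "x \<in> P"
    show "succ x \<in> P"
      by (rule succ_P(1)[OF x])
    show "head \<Gamma> (fst x) = tail \<Gamma> (fst (succ x))"
      using succ_P(2)[OF x] by (simp add: F_ends)
    obtain C where C: "C \<in> components (core F)" "x \<in> arcs C"
      using PE[OF x] by blast
    obtain k v e D L w d where param: "circle_param C k v e" "e 0 = x" "D \<in> components S" "circle_param D L w d"
      "d 0 = snd x" "L = period (snd x)" "\<And>n. (succ ^^ n) x = e n" "\<And>n. snd (e n) = d n" "\<And>n. period (d n) = L"
      using core_arc_cases[OF C] by metis
    show "0 < period (snd x)"
      using param(4,6) by (simp add: circle_param_def)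
    show "period (snd (succ x)) = period (snd x)"
      using param(6) param(7)[of 1] param(8,9) by simp
    \<comment> \<open>The circle of \<open>S\<close> closes up after \<open>L\<close> steps. The
      point above it need not have returned, but its label is determined by its arc in
      \<open>S\<close>.\<close>
    have "d L = d 0"
      using param(4) by (simp add: circle_param_def cong_def)
    then have "amap \<gamma> (fst (e L)) = amap \<gamma> (fst (e 0))"
      using core_component_arc(1)[OF C(1) param(1)] param(8) F_arcs by metis
    then show "enc (amap \<gamma> (fst ((succ ^^ period (snd x)) x))) = enc (amap \<gamma> (fst x))"
      using param by simp
    fix y assume y: "y \<in> P" and tails: "tail \<Gamma> (fst x) = tail \<Gamma> (fst y)"
      and eq: "\<And>i. i < period (snd x) + period (snd y) \<Longrightarrow>
        enc (amap \<gamma> (fst ((succ ^^ i) x))) = enc (amap \<gamma> (fst ((succ ^^ i) y)))"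
    obtain C' where C': "C' \<in> components (core F)" "y \<in> arcs C'"
      using PE[OF y] by blast
    obtain k' v' e' D' L' w' d' where param': "circle_param C' k' v' e'" "e' 0 = y" "D' \<in> components S"
      "circle_param D' L' w' d'" "d' 0 = snd y" "L' = period (snd y)" "\<And>n. (succ ^^ n) y = e' n"
      "\<And>n. snd (e' n) = d' n"
      using core_arc_cases[OF C'] by metis
    have "(succ ^^ i) z \<in> P" if "z \<in> P" for i z
      using that by (induction i) (auto simp: succ_P)
    then have in_P: "e i \<in> P" "e' i \<in> P" for i
      using x y param(7) param'(7) by metis+
    have \<gamma>_eq: "amap \<gamma> (fst (e i)) = amap \<gamma> (fst (e' i))" if "i < L + L'" for i
      using eq[of i] that in_P param(6,7) param'(6,7) by (intro encD) auto
    have "amap l (d i) = amap l (d' i)" if "i < L + L'" for i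
      using \<gamma>_eq[OF that] PF[OF in_P(1), of i] PF[OF in_P(2), of i] param(8)[of i] param'(8)[of i]
      by (simp add: F_arcs)
    \<comment> \<open>Equal labels over the sum of both periods force equal arcs in
      \<open>S\<close>; the common origin and label then fix the arc in
      \<open>\<Gamma>\<close>.\<close>
    then have "snd x = snd y"
      using S_separated[OF param(3,4) param'(3,4)] param(5) param'(5) by simp
    moreover have "amap \<gamma> (fst x) = amap \<gamma> (fst y)"
      using \<gamma>_eq[of 0] param(2,4) param'(2) by (simp add: circle_param_def)
    then have "fst x = fst y"
      using tails PF[OF x] PF[OF y] by (intro \<gamma>_tail_inj) (auto simp: F_arcs)
    ultimately show "x = y"
      by (simp add: prod_eq_iff)
  qed
  have "\<exists>x\<in>P. \<forall>y\<in>P. fst y = fst x \<longrightarrow> y = x"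
  proof (rule ex_edge_covered_once)
    obtain C where "C \<in> Y"
      using Y(2) by blast
    then have C: "C \<in> components (core F)"
      using Y(3) by blast
    show "1 \<le> b"
      using betti1_pos[OF C] b by (simp add: one_enat_def)
    obtain k v e where "circle_param C k v e"
      using core_component_param[OF C] by blast
    then have "e 0 \<in> arcs C"
      by (rule circle_param_in)
    then have "e 0 \<in> P"
      using \<open>C \<in> Y\<close> by (auto simp: P_def)
    then show "P \<noteq> {}"
      by blast
    \<comment> \<open>The circles run on, so every target of a used arc is also an origin; the
      origins alone can serve as the vertex set in
      \<open>betti1_ge_arcs_minus_verts\<close>.\<close>
    have "fst ` P \<subseteq> arcs \<Gamma>"
      using PF by (auto simp: F_arcs)
    moreover have "head \<Gamma> ` fst ` P \<subseteq> tail \<Gamma> ` fst ` P"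
    proof clarify
      fix x assume x: "x \<in> P"
      then have "head \<Gamma> (fst x) = tail \<Gamma> (fst (succ x))"
        using succ_P(2) by (simp add: F_ends)
      then show "head \<Gamma> (fst x) \<in> tail \<Gamma> ` fst ` P"
        using succ_P(1)[OF x] by blast
    qed
    ultimately have "enat (card (fst ` P) - card (tail \<Gamma> ` fst ` P)) \<le> betti1 \<Gamma>"
      using fin by (intro betti1_ge_arcs_minus_verts) auto
    then show "card (fst ` P) \<le> card (tail \<Gamma> ` fst ` P) + b"
      using b by simp
    fix x assume "x \<in> P"
    then obtain C where C: "C \<in> Y" "C \<in> components (core F)" "x \<in> arcs C"
      using PE by blast
    obtain k v e D L w d where param: "circle_param C k v e" "D \<in> components S" "circle_param D L w d"
      "snd (v 0) = w 0" "L = period (snd x)" "\<And>n. (succ ^^ n) x = e n"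
      using core_arc_cases[OF C(2,3)] by metis
    have "vmap proj_snd (v 0) = w 0"
      using param(4) by (simp add: proj_snd_def)
    \<comment> \<open>Degree at least \<open>12 * b\<close> over a circle of length \<open>L\<close>
      leaves room for \<open>12 * b * L\<close> distinct arcs on the core circle.\<close>
    then have "12 * b * L \<le> k"
      by (rule cycle_degree_le[OF param(1) core_component(4)[OF C(2)] param(3,2) _ degree[OF C(1)]])
    then have "inj_on e {..<12 * b * period (snd x)}"
      using inj_on_subset[OF circle_param_card(4)[OF param(1)]] param(5) by auto
    then show "inj_on (\<lambda>i. (succ ^^ i) x) {..<12 * b * period (snd x)}"
      using param(6) by simp
  qed
  then obtain x where x: "x \<in> P" "\<And>y. y \<in> P \<Longrightarrow> fst y = fst x \<Longrightarrow> y = x"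
    by blast
  then obtain C where C: "C \<in> Y" "C \<in> components (core F)" "x \<in> arcs C"
    using PE by blast
  have "{z \<in> arcs C. fst z = fst x} \<noteq> {}"
    using C(3) by blast
  then have "Poly_Mapping.lookup (chain C) (fst x) \<noteq> 0"
    using core_component_finite[OF C(2)] by (simp add: lookup_chain)
  moreover have "Poly_Mapping.lookup (chain C') (fst x) = 0" if C': "C' \<in> Y - {C}" for C'
  proof -
    have comp: "C' \<in> components (core F)"
      using C' Y(3) by blast
    have "fst z \<noteq> fst x" if z: "z \<in> arcs C'" for z
    proof
      assume "fst z = fst x"
      moreover have "z \<in> P"
        using z C' unfolding P_def by blast
      ultimately have "z = x"
        using x(2) by blast
      then show False
        using wf_digraph.components_disjoint[OF wf_core comp C(2), of x] z C(3) C' by blast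
    qed
    then have "{z \<in> arcs C'. fst z = fst x} = {}"
      by blast
    then show ?thesis
      using core_component_finite[OF comp] by (simp add: lookup_chain)
  qed
  ultimately show ?thesis
    using C(1) by blast
qed

text \<open>A finite degree cannot reach \<open>12 * betti1 \<Gamma>\<close> if that is infinite, so
  a nonempty \<open>X\<close> forces a finite Betti number \<open>b\<close>. Every finite subset of
  \<open>X\<close> then has at most \<open>b\<close> elements, which also makes \<open>X\<close>
  finite.\<close>

lemma card_high_degree:
  assumes X: "X = {C \<in> components (core F). enat (cycle_degree C S proj_snd) \<ge> 12 * betti1 \<Gamma>}"
  shows "finite X \<and> enat (card X) \<le> betti1 \<Gamma>"
proof (cases "X = {}")
  case True
  then show ?thesis
    by (simp flip: zero_enat_def)
next
  case False
  then obtain C0 where C0: "C0 \<in> components (core F)" "12 * betti1 \<Gamma> \<le> enat (cycle_degree C0 S proj_snd)"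
    using X by auto
  then obtain b where b: "betti1 \<Gamma> = enat b"
    by (cases "betti1 \<Gamma>") (auto simp: imult_infinity_right)
  have degree: "12 * b \<le> cycle_degree C S proj_snd" if "C \<in> X" for C
    using that by (simp add: X b numeral_eq_enat)
  have bound: "card Y \<le> b" if Y: "finite Y" "Y \<subseteq> X" for Y
  proof -
    have "enat (card Y) \<le> betti1 \<Gamma>"
    proof (rule betti1_ge_card_chains[OF Y(1), of chain])
      show "chain C \<in> cycle_space \<Gamma>" if "C \<in> Y" for C
        using that Y X by (intro chain_cycle_space) auto
      fix Z assume "Z \<subseteq> Y" "Z \<noteq> {}"
      then show "\<exists>C\<in>Z. \<exists>e. Poly_Mapping.lookup (chain C) e \<noteq> 0 \<and>
        (\<forall>C'\<in>Z - {C}. Poly_Mapping.lookup (chain C') e = 0)"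
        using Y X by (intro ex_private_arc[OF _ _ _ b] degree) (auto intro: finite_subset)
    qed
    then show ?thesis
      by (simp add: b)
  qed
  have "finite X"
  proof (rule ccontr)
    assume "infinite X"
    then obtain Y where "finite Y" "card Y = Suc b" "Y \<subseteq> X"
      using infinite_arbitrarily_large by blast
    then show False
      using bound[of Y] by simp
  qed
  then show ?thesis
    using bound[of X] b by simp
qed

end

theorem theorem4p20:
  fixes \<Gamma> :: "('a, 'b) pre_digraph"
    and \<Delta> :: "('c, 'd) pre_digraph"
    and S :: "('e, 'f) pre_digraph"
    and \<gamma> :: "('a, 'b, 'c, 'd) graph_map"
    and l :: "('e, 'f, 'c, 'd) graph_map"
  assumes "immersion \<Gamma> \<Delta> \<gamma>"
    and "immersion S \<Delta> l"
    and "\<forall>C \<in> components S. is_circle C"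
    and "\<forall>C \<in> components S. primitive_cycle C \<Delta> l"
    and "\<forall>C \<in> components S. \<forall>C' \<in> components S. C \<noteq> C' \<longrightarrow> \<not> equivalent_cycles C l C' l"
  defines "X \<equiv> {C \<in> components (core (fibre_product \<Gamma> \<gamma> S l)).
                  enat (cycle_degree C S proj_snd) \<ge> 12 * betti1 \<Gamma>}"
  shows "finite X \<and> enat (card X) \<le> betti1 \<Gamma>"
proof -
  interpret immersed_circles \<Gamma> \<Delta> S \<gamma> l
    using assms(1-5) by unfold_locales
  show ?thesis
    by (rule card_high_degree) (simp add: X_def F_def)
qed

end
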